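(* Let $V=\mathbb{C}^3$ with its natural $\mathrm{SL}(3)=\mathrm{SL}(3,\mathbb{C})$-action and standard basis $e_1,e_2,e_3$, and let $a_1,\dots,a_{10}$ be the basis of $S^3V$ given by $$a_1=e_1^3,\ a_2=e_2^3,\ a_3=e_3^3,\ a_4=e_1^2e_2,\ a_5=e_1^2e_3,\ a_6=e_2^2e_3,\ a_7=e_1e_2^2,\ a_8=e_1e_3^2,\ a_9=e_2e_3^2,\ a_{10}=e_1e_2e_3.$$ Let $v\in\Lambda^3(S^3V)$ be the element \begin{align*} v={}&a_1\wedge a_2\wedge a_3-3\,a_3\wedge a_4\wedge a_7-3\,a_1\wedge a_6\wedge a_9+3\,a_2\wedge a_5\wedge a_8\\ &+6\,a_7\wedge a_8\wedge a_{10}-6\,a_4\wedge a_9\wedge a_{10}+6\,a_5\wedge a_6\wedge a_{10}\\ &+3\,a_5\wedge a_7\wedge a_9+3\,a_4\wedge a_6\wedge a_8 , \end{align*} and let $\ast v\in\Lambda^7(S^3V)$ be the Hodge dual of $v$ with respect to the volume form $\mathrm{vol}=a_1\wedge a_2\wedge\cdots\wedge a_{10}$. Then the algebra of invariants $\Lambda(S^3V)^{\mathrm{SL}(3)}$ is generated (as a unital $\mathbb{C}$-algebra) by $v$ and $\ast v$, and $\ast v$ is given explicitly by \begin{align*} \ast v={}&a_4\wedge a_5\wedge a_6\wedge a_7\wedge a_8\wedge a_9\wedge a_{10}-\tfrac13\,a_1\wedge a_2\wedge a_5\wedge a_6\wedge a_8\wedge a_9\wedge a_{10}\\ &-\tfrac13\,a_2\wedge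 a_3\wedge a_4\wedge a_5\wedge a_7\wedge a_8\wedge a_{10}-\tfrac13\,a_1\wedge a_3\wedge a_4\wedge a_6\wedge a_7\wedge a_9\wedge a_{10}\\ &-\tfrac19\,a_1\wedge a_2\wedge a_3\wedge a_4\wedge a_5\wedge a_6\wedge a_9+\tfrac19\,a_1\wedge a_2\wedge a_3\wedge a_5\wedge a_6\wedge a_7\wedge a_8\\ &-\tfrac19\,a_1\wedge a_2\wedge a_3\wedge a_4\wedge a_7\wedge a_8\wedge a_9-\tfrac19\,a_1\wedge a_2\wedge a_3\wedge a_4\wedge a_6\wedge a_8\wedge a_{10}\\ &+\tfrac19\,a_1\wedge a_2\wedge a_3\wedge a_5\wedge a_7\wedge a_9\wedge a_{10}. \end{align*}
   Context: The ground field is $\mathbb{C}$. $S^3V$ is the third symmetric power of $V=\mathbb{C}^3$, realized as the image of the symmetrization map on $V^{\otimes 3}$: for $i_1,i_2,i_3\in\{1,2,3\}$, $$e_{i_1}e_{i_2}e_{i_3}=\frac{1}{3!}\sum_{\sigma}e_{i_{\sigma(1)}}\otimes e_{i_{\sigma(2)}}\otimes e_{i_{\sigma(3)}},$$ the sum being over all permutations $\sigma$ of $\{1,2,3\}$. $\Lambda(S^3V)=\bigoplus_{k=0}^{10}\Lambda^k(S^3V)$ is the exterior algebra of the $10$-dimensional space $S^3V$, with the induced action of $\mathrm{SL}(3)$ by algebra automorphisms, and $\Lambda(S^3V)^{\mathrm{SL}(3)}$ is the subalgebra of elements fixed by $\mathrm{SL}(3)$. The standard inner product on $V$ (with $e_1,e_2,e_3$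 orthonormal) induces an inner product on $V^{\otimes 3}$ (with the $e_i\otimes e_j\otimes e_k$ orthonormal), hence by restriction on $S^3V\subset V^{\otimes 3}$, and then on each $\Lambda^p(S^3V)$ by $\langle u_1\wedge\cdots\wedge u_p,\,w_1\wedge\cdots\wedge w_p\rangle=\det(\langle u_i,w_j\rangle)$. With respect to the fixed element $\mathrm{vol}\in\Lambda^{10}(S^3V)$, the Hodge dual $\ast v\in\Lambda^{7}(S^3V)$ of the element $v\in\Lambda^3(S^3V)$ is the unique element with $u\wedge\ast v=\langle u,v\rangle\,\mathrm{vol}$ for all $u\in\Lambda^3(S^3V)$ (the inner product being taken linear in $u$); in particular $v\wedge\ast v=\langle v,v\rangle\,\mathrm{vol}$. *)

theory Defs
  imports "HOL-Analysis.Analysis"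
begin

section \<open>The exterior algebra of a finite-dimensional coordinate space\<close>

text \<open>
  The exterior algebra of \<open>\<complex>\<^sup>n\<close> (coordinates indexed by a finite type) is modelled by its
  standard basis: the coordinate at a set \<open>S\<close> is the coefficient of the wedge product of the
  \<open>e\<^sub>i\<close>, \<open>i \<in> S\<close>, taken in increasing order. The order on the index type is the one induced
  by \<^const>\<open>to_nat\<close>; any other total order gives an isomorphic algebra.
\<close>

type_synonym 'n ext = "(complex, 'n set) vec"

definition shuffle_sign :: "'n::finite set \<Rightarrow> 'n set \<Rightarrow> complex" where
  "shuffle_sign A B = (\<Prod>a\<in>A. \<Prod>b\<in>B. if to_nat b < to_nat a then - 1 else 1)"

definition wedge :: "'n::finite ext \<Rightarrow> 'n ext \<Rightarrow> 'n ext" (infixr \<open>\<and>\<^sub>E\<close> 72) where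
  "x \<and>\<^sub>E y = (\<chi> S. \<Sum>A\<in>Pow S. shuffle_sign A (S - A) * x $ A * y $ (S - A))"

definition ext_one :: "'n::finite ext" where
  "ext_one = axis {} 1"

definition ext_vec :: "complex ^ 'n \<Rightarrow> 'n::finite ext" where
  "ext_vec u = (\<Sum>i\<in>UNIV. u $ i *s axis {i} 1)"

definition wedge_list :: "(complex ^ 'n) list \<Rightarrow> 'n::finite ext" where
  "wedge_list us = foldr (\<lambda>u x. ext_vec u \<and>\<^sub>E x) us ext_one"

definition ordered_list :: "'n::finite set \<Rightarrow> 'n list" where
  "ordered_list S = map from_nat (sorted_list_of_set (to_nat ` S))"

text \<open>
  For a linear map \<open>f\<close>, the algebra homomorphism of exterior algebras extending \<open>f\<close>;
  see \<open>ext_map_wedge\<close> below.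
\<close>

definition ext_map :: "(complex ^ 'n \<Rightarrow> complex ^ 'm) \<Rightarrow> 'n::finite ext \<Rightarrow> 'm::finite ext" where
  "ext_map f x = (\<Sum>S\<in>UNIV. x $ S *s wedge_list (map (\<lambda>i. f (axis i 1)) (ordered_list S)))"

definition cinner :: "complex ^ 'n::finite \<Rightarrow> complex ^ 'n \<Rightarrow> complex" where
  "cinner u w = (\<Sum>i\<in>UNIV. u $ i * cnj (w $ i))"

text \<open>
  The inner product on the exterior algebra for which the standard basis is orthonormal. On
  decomposable elements it is given by the Gram determinant; see \<open>ext_inner_wedge_list\<close> below.
\<close>

definition ext_inner :: "'n::finite ext \<Rightarrow> 'n ext \<Rightarrow> complex" where
  "ext_inner x y = (\<Sum>S\<in>UNIV. x $ S * cnj (y $ S))"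

text \<open>
  The exterior algebra of a subspace \<open>W\<close> and its homogeneous components, as subspaces of the
  exterior algebra of the ambient space.
\<close>

definition ext_power :: "nat \<Rightarrow> (complex ^ 'n) set \<Rightarrow> 'n::finite ext set" where
  "ext_power k W = vec.span {wedge_list us |us. length us = k \<and> set us \<subseteq> W}"

definition ext_algebra :: "(complex ^ 'n) set \<Rightarrow> 'n::finite ext set" where
  "ext_algebra W = vec.span {wedge_list us |us. set us \<subseteq> W}"

inductive_set subalgebra_generated :: "'n::finite ext set \<Rightarrow> 'n ext set" for X where
  one: "ext_one \<in> subalgebra_generated X"
| gen: "x \<in> X \<Longrightarrow> x \<in> subalgebra_generated X"
| add: "x \<in> subalgebra_generated X \<Longrightarrow> y \<in> subalgebra_generated X \<Longrightarrow>
    x + y \<in> subalgebra_generated X"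
| scale: "x \<in> subalgebra_generated X \<Longrightarrow> c *s x \<in> subalgebra_generated X"
| wedge: "x \<in> subalgebra_generated X \<Longrightarrow> y \<in> subalgebra_generated X \<Longrightarrow>
    x \<and>\<^sub>E y \<in> subalgebra_generated X"

subsection \<open>The model has the defining properties of the exterior algebra\<close>

lemma shuffle_sign_union_left:
  "A \<inter> B = {} \<Longrightarrow> shuffle_sign (A \<union> B) C = shuffle_sign A C * shuffle_sign B C"
  unfolding shuffle_sign_def by (rule prod.union_disjoint) auto

lemma shuffle_sign_union_right:
  assumes "B \<inter> C = {}"
  shows "shuffle_sign A (B \<union> C) = shuffle_sign A B * shuffle_sign A C"
proof -
  have "(\<Prod>b\<in>B \<union> C. if to_nat b < to_nat a then - 1 else 1) =
    (\<Prod>b\<in>B. if to_nat b < to_nat a then - 1 else (1::complex)) *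
    (\<Prod>b\<in>C. if to_nat b < to_nat a then - 1 else 1)" for a :: 'a
    by (rule prod.union_disjoint) (use assms in auto)
  then show ?thesis by (simp add: shuffle_sign_def prod.distrib)
qed

lemma shuffle_sign_empty [simp]: "shuffle_sign {} B = 1" "shuffle_sign A {} = 1"
  by (auto simp: shuffle_sign_def)

lemma shuffle_sign_swap: "i \<noteq> j \<Longrightarrow> shuffle_sign {i} {j} = - shuffle_sign {j} {i}"
  using inj_eq[OF inj_to_nat, of i j] by (auto simp: shuffle_sign_def not_less_iff_gr_or_eq)

lemma shuffle_sign_square [simp]: "shuffle_sign A B * shuffle_sign A B = 1"
proof -
  have "shuffle_sign A B * shuffle_sign A B =
    (\<Prod>a\<in>A. \<Prod>b\<in>B. (if to_nat b < to_nat a then - 1 else 1) * (if to_nat b < to_nat a then - 1 else 1))"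
    by (simp only: shuffle_sign_def prod.distrib)
  also have "\<dots> = 1" by (intro prod.neutral ballI) auto
  finally show ?thesis .
qed

lemma shuffle_sign_square' [simp]: "shuffle_sign A B * (shuffle_sign A B * c) = c"
  by (simp flip: mult.assoc)

lemma shuffle_sign_insert_right:
  "j \<notin> B \<Longrightarrow> shuffle_sign A (insert j B) = shuffle_sign A {j} * shuffle_sign A B"
  using shuffle_sign_union_right[of "{j}" B A] by simp

lemma cnj_shuffle_sign [simp]: "cnj (shuffle_sign A B) = shuffle_sign A B"
  unfolding shuffle_sign_def cnj_prod by (intro prod.cong) auto

lemma wedge_add_left: "(x + y) \<and>\<^sub>E z = x \<and>\<^sub>E z + y \<and>\<^sub>E z"
  by (simp add: wedge_def vec_eq_iff algebra_simps sum.distrib)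

lemma wedge_add_right: "x \<and>\<^sub>E (y + z) = x \<and>\<^sub>E y + x \<and>\<^sub>E z"
  by (simp add: wedge_def vec_eq_iff algebra_simps sum.distrib)

lemma wedge_scale_left: "(c *s x) \<and>\<^sub>E y = c *s (x \<and>\<^sub>E y)"
  by (simp add: wedge_def vec_eq_iff sum_distrib_left algebra_simps)

lemma wedge_scale_right: "x \<and>\<^sub>E (c *s y) = c *s (x \<and>\<^sub>E y)"
  by (simp add: wedge_def vec_eq_iff sum_distrib_left algebra_simps)

lemma wedge_assoc: "(x \<and>\<^sub>E y) \<and>\<^sub>E z = x \<and>\<^sub>E (y \<and>\<^sub>E z)"
proof (subst vec_eq_iff, intro allI)
  fix S
  have "((x \<and>\<^sub>E y) \<and>\<^sub>E z) $ S = (\<Sum>A\<in>Pow S. \<Sum>B\<in>Pow A.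
      shuffle_sign A (S - A) * shuffle_sign B (A - B) * x $ B * y $ (A - B) * z $ (S - A))"
    by (simp add: wedge_def sum_distrib_left sum_distrib_right mult_ac)
  also have "\<dots> = (\<Sum>(A, B)\<in>Sigma (Pow S) Pow.
      shuffle_sign A (S - A) * shuffle_sign B (A - B) * x $ B * y $ (A - B) * z $ (S - A))"
    by (rule sum.Sigma) auto
  also have "\<dots> = (\<Sum>(B, C)\<in>Sigma (Pow S) (\<lambda>B. Pow (S - B)).
      shuffle_sign B (S - B) * shuffle_sign C (S - B - C) * x $ B * y $ C * z $ (S - B - C))"
  proof (rule sum.reindex_bij_witness[where j = "\<lambda>(A, B). (B, A - B)" and i = "\<lambda>(B, C). (B \<union> C, B)"])
    fix p assume p: "p \<in> Sigma (Pow S) Pow"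
    then obtain A B where [simp]: "p = (A, B)" and A: "A \<subseteq> S" "B \<subseteq> A" by auto
    have "shuffle_sign A (S - A) = shuffle_sign B (S - A) * shuffle_sign (A - B) (S - A)"
      using shuffle_sign_union_left[of B "A - B" "S - A"] A by (simp add: Un_absorb1)
    moreover have "shuffle_sign B (S - B) = shuffle_sign B (A - B) * shuffle_sign B (S - A)"
    proof -
      have *: "S - B = (A - B) \<union> (S - A)" using A by auto
      show ?thesis unfolding * by (rule shuffle_sign_union_right) auto
    qed
    moreover have "S - B - (A - B) = S - A" using A by auto
    ultimately show "(case case p of (A, B) \<Rightarrow> (B, A - B) of (B, C) \<Rightarrow>
        shuffle_sign B (S - B) * shuffle_sign C (S - B - C) * x $ B * y $ C * z $ (S - B - C)) =
      (case p of (A, B) \<Rightarrow>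
        shuffle_sign A (S - A) * shuffle_sign B (A - B) * x $ B * y $ (A - B) * z $ (S - A))"
      by simp
  qed auto
  also have "\<dots> = (\<Sum>B\<in>Pow S. \<Sum>C\<in>Pow (S - B).
      shuffle_sign B (S - B) * shuffle_sign C (S - B - C) * x $ B * y $ C * z $ (S - B - C))"
    by (rule sum.Sigma[symmetric]) auto
  also have "\<dots> = (x \<and>\<^sub>E (y \<and>\<^sub>E z)) $ S"
    by (simp add: wedge_def sum_distrib_left sum_distrib_right mult_ac)
  finally show "((x \<and>\<^sub>E y) \<and>\<^sub>E z) $ S = (x \<and>\<^sub>E (y \<and>\<^sub>E z)) $ S" .
qed

lemma ext_vec_nth: "ext_vec u $ S = (\<Sum>i\<in>UNIV. if S = {i} then u $ i else 0)"
  by (auto simp: ext_vec_def axis_def intro!: sum.cong)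

lemma ext_vec_add: "ext_vec (u + w) = ext_vec u + ext_vec w"
  by (simp add: ext_vec_def vec.scale_left_distrib sum.distrib)

lemma ext_vec_scale: "ext_vec (c *s u) = c *s ext_vec u"
  by (simp add: ext_vec_def vec.scale_sum_right)

lemma wedge_one_left [simp]: "ext_one \<and>\<^sub>E x = x"
proof -
  have "(ext_one \<and>\<^sub>E x) $ S = (\<Sum>A\<in>Pow S. if A = {} then x $ S else 0)" for S
    unfolding wedge_def ext_one_def axis_def vec_lambda_beta by (intro sum.cong) auto
  then show ?thesis by (simp add: vec_eq_iff)
qed

lemma wedge_one_right [simp]: "x \<and>\<^sub>E ext_one = x"
proof -
  have "(x \<and>\<^sub>E ext_one) $ S = (\<Sum>A\<in>Pow S. if A = S then x $ S else 0)" for S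
    unfolding wedge_def ext_one_def axis_def vec_lambda_beta by (intro sum.cong) auto
  then show ?thesis by (simp add: vec_eq_iff)
qed

lemma ext_vec_wedge_nth:
  "(ext_vec u \<and>\<^sub>E y) $ S = (\<Sum>i\<in>S. u $ i * shuffle_sign {i} (S - {i}) * y $ (S - {i}))"
proof -
  have "(ext_vec u \<and>\<^sub>E y) $ S = (\<Sum>A\<in>Pow S. \<Sum>i\<in>UNIV.
      if A = {i} then u $ i * shuffle_sign A (S - A) * y $ (S - A) else 0)"
    unfolding wedge_def ext_vec_nth
    by (auto simp: sum_distrib_left sum_distrib_right intro!: sum.cong)
  also have "\<dots> = (\<Sum>i\<in>UNIV. \<Sum>A\<in>Pow S.
      if A = {i} then u $ i * shuffle_sign A (S - A) * y $ (S - A) else 0)"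
    by (rule sum.swap)
  also have "\<dots> = (\<Sum>i\<in>UNIV. if i \<in> S then u $ i * shuffle_sign {i} (S - {i}) * y $ (S - {i}) else 0)"
    by (intro sum.cong) auto
  also have "\<dots> = (\<Sum>i\<in>S. u $ i * shuffle_sign {i} (S - {i}) * y $ (S - {i}))"
    by (simp add: sum.If_cases)
  finally show ?thesis .
qed

lemma ext_vec_anticommute':
  "ext_vec u \<and>\<^sub>E ext_vec w \<and>\<^sub>E y = - (ext_vec w \<and>\<^sub>E ext_vec u \<and>\<^sub>E y)"
proof (subst vec_eq_iff, intro allI)
  fix S
  define F where "F u w i j = u $ i * w $ j * shuffle_sign {i} (S - {i}) *
    shuffle_sign {j} (S - {i} - {j}) * y $ (S - {i} - {j})" for u w :: "complex ^ 'a" and i j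
  have E: "(ext_vec u \<and>\<^sub>E ext_vec w \<and>\<^sub>E y) $ S = (\<Sum>i\<in>S. \<Sum>j\<in>S. if i = j then 0 else F u w i j)"
    for u w
  proof -
    have "(ext_vec u \<and>\<^sub>E ext_vec w \<and>\<^sub>E y) $ S = (\<Sum>i\<in>S. \<Sum>j\<in>S - {i}. F u w i j)"
      by (simp add: ext_vec_wedge_nth F_def sum_distrib_left mult_ac)
    also have "\<dots> = (\<Sum>i\<in>S. \<Sum>j\<in>S. if i = j then 0 else F u w i j)"
      by (intro sum.cong refl sum.mono_neutral_cong_left) auto
    finally show ?thesis .
  qed
  have F: "F u w i j = - F w u j i" if "i \<in> S" "j \<in> S" "i \<noteq> j" for i j
  proof -
    define T where "T = S - {i, j}"
    have *: "S - {i} = insert j T" "S - {j} = insert i T" "insert j T - {j} = T"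
      "insert i T - {i} = T" "i \<notin> T" "j \<notin> T"
      using that by (auto simp: T_def)
    show ?thesis
      unfolding F_def * using shuffle_sign_swap[OF that(3)] shuffle_sign_insert_right[OF *(5)] shuffle_sign_insert_right[OF *(6)]
      by simp
  qed
  have "(ext_vec u \<and>\<^sub>E ext_vec w \<and>\<^sub>E y) $ S =
      (\<Sum>i\<in>S. \<Sum>j\<in>S. - (if j = i then 0 else F w u j i))"
    unfolding E by (intro sum.cong refl) (auto simp: F)
  also have "\<dots> = - (ext_vec w \<and>\<^sub>E ext_vec u \<and>\<^sub>E y) $ S"
    unfolding E sum_negf by (subst sum.swap) simp
  finally show "(ext_vec u \<and>\<^sub>E ext_vec w \<and>\<^sub>E y) $ S = (- (ext_vec w \<and>\<^sub>E ext_vec u \<and>\<^sub>E y)) $ S"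
    by simp
qed

lemma ext_vec_anticommute: "ext_vec u \<and>\<^sub>E ext_vec w = - (ext_vec w \<and>\<^sub>E ext_vec u)"
  using ext_vec_anticommute'[of u w ext_one] by simp

lemma ext_vec_square: "ext_vec u \<and>\<^sub>E ext_vec u = 0"
  using ext_vec_anticommute[of u u] by (simp add: vec_eq_iff)

lemma wedge_list_Nil [simp]: "wedge_list [] = ext_one"
  by (simp add: wedge_list_def)

lemma wedge_list_Cons [simp]: "wedge_list (u # us) = ext_vec u \<and>\<^sub>E wedge_list us"
  by (simp add: wedge_list_def)

lemma wedge_zero_left [simp]: "0 \<and>\<^sub>E x = 0"
  using wedge_scale_left[of 0 0 x] by simp

lemma wedge_zero_right [simp]: "x \<and>\<^sub>E 0 = 0"
  using wedge_scale_right[of x 0 0] by simp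

lemma wedge_minus_right: "x \<and>\<^sub>E (- y) = - (x \<and>\<^sub>E y)"
  using wedge_scale_right[of x "- 1" y] by (simp add: vec.scale_minus_left)

lemma wedge_sum_left: "(\<Sum>i\<in>I. f i) \<and>\<^sub>E x = (\<Sum>i\<in>I. f i \<and>\<^sub>E x)"
  by (induction I rule: infinite_finite_induct) (auto simp: wedge_add_left)

lemma wedge_sum_right: "x \<and>\<^sub>E (\<Sum>i\<in>I. f i) = (\<Sum>i\<in>I. x \<and>\<^sub>E f i)"
  by (induction I rule: infinite_finite_induct) (auto simp: wedge_add_right)

abbreviation to_nat_sorted :: "'n::finite list \<Rightarrow> bool" where
  "to_nat_sorted \<equiv> sorted_wrt (\<lambda>i j. to_nat i < to_nat j)"

lemma ordered_list_eq:
  assumes "to_nat_sorted l"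
  shows "ordered_list (set l) = l"
proof -
  have "sorted_wrt (<) (map to_nat l)" using assms by (simp add: sorted_wrt_map)
  then have "sorted_list_of_set (set (map to_nat l)) = map to_nat l"
    by (intro sorted_list_of_set.idem_if_sorted_distinct) (simp_all add: strict_sorted_iff)
  then show ?thesis by (simp add: ordered_list_def comp_def)
qed

lemma ordered_list_empty [simp]: "ordered_list {} = []"
  by (simp add: ordered_list_def)

lemma set_ordered_list [simp]: "set (ordered_list S) = S"
  by (simp add: ordered_list_def image_image)

lemma to_nat_sorted_ordered_list: "to_nat_sorted (ordered_list S)"
proof -
  let ?l = "sorted_list_of_set (to_nat ` S)"
  have "sorted_wrt (<) ?l" by simp
  moreover have "to_nat (from_nat k :: 'a) = k" if "k \<in> set ?l" for k using that by auto
  ultimately show ?thesis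
    unfolding ordered_list_def sorted_wrt_map
    by (metis (mono_tags, lifting) sorted_wrt_mono_rel)
qed

lemma wedge_ordered_insert:
  "ext_vec (F i) \<and>\<^sub>E wedge_list (map F (ordered_list S)) =
    (if i \<in> S then 0
     else shuffle_sign {i} S *s wedge_list (map F (ordered_list (insert i S))))"
proof -
  have "ext_vec (F i) \<and>\<^sub>E wedge_list (map F l) =
    (if i \<in> set l then 0
     else shuffle_sign {i} (set l) *s wedge_list (map F (ordered_list (insert i (set l)))))"
    if "to_nat_sorted l" for l
    using that
  proof (induction l)
    case Nil
    show ?case using ordered_list_eq[of "[i]"] by simp
  next
    case (Cons a l)
    have st: "to_nat_sorted l" and a: "\<And>b. b \<in> set l \<Longrightarrow> to_nat a < to_nat b"
      using Cons.prems by auto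
    have al: "a \<notin> set l" using a by blast
    consider "i = a" | "to_nat i < to_nat a" | "to_nat a < to_nat i"
      using inj_eq[OF inj_to_nat, of i a] by linarith
    then show ?case
    proof cases
      case 1
      then show ?thesis by (simp flip: wedge_assoc add: ext_vec_square)
    next
      case 2
      then have s: "to_nat_sorted (i # a # l)" using Cons.prems a by fastforce
      then have "i \<notin> set (a # l)" by auto
      moreover have "shuffle_sign {i} (set (a # l)) = 1"
        unfolding shuffle_sign_def using s by (intro prod.neutral ballI) auto
      ultimately show ?thesis using ordered_list_eq[OF s] by simp
    next
      case 3
      then have ia: "i \<noteq> a" by auto
      have *: "ext_vec (F i) \<and>\<^sub>E wedge_list (map F (a # l)) =
          - (ext_vec (F a) \<and>\<^sub>E ext_vec (F i) \<and>\<^sub>E wedge_list (map F l))"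
        using ext_vec_anticommute' by simp
      show ?thesis
      proof (cases "i \<in> set l")
        case True
        then show ?thesis unfolding * Cons.IH[OF st] by simp
      next
        case False
        let ?m = "ordered_list (insert i (set l))"
        have "to_nat_sorted (a # ?m)"
          using to_nat_sorted_ordered_list a 3 by auto
        then have m: "ordered_list (insert i (set (a # l))) = a # ?m"
          using ordered_list_eq[of "a # ?m"] by (simp add: insert_commute)
        have "shuffle_sign {i} {a} = - 1" using 3 by (simp add: shuffle_sign_def)
        then have "shuffle_sign {i} (set (a # l)) = - shuffle_sign {i} (set l)"
          using shuffle_sign_insert_right[OF al, of "{i}"] by simp
        then show ?thesis
          unfolding * Cons.IH[OF st] m using False ia
          by (simp add: wedge_scale_right vec.scale_minus_left)
      qed
    qed
  qed
  from this[OF to_nat_sorted_ordered_list[of S]] show ?thesis by simp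
qed

lemma ext_vec_axis_wedge_axis:
  "ext_vec (axis i 1) \<and>\<^sub>E axis S 1 = (if i \<in> S then 0 else shuffle_sign {i} S *s axis (insert i S) 1)"
proof -
  have "(ext_vec (axis i 1) \<and>\<^sub>E axis S 1) $ T =
      (\<Sum>j\<in>T. if j = i then shuffle_sign {i} (T - {i}) * axis S 1 $ (T - {i}) else 0)" for T
    unfolding ext_vec_wedge_nth by (intro sum.cong) (auto simp: axis_def)
  then have "(ext_vec (axis i 1) \<and>\<^sub>E axis S 1) $ T =
      (if i \<in> T then shuffle_sign {i} (T - {i}) * axis S 1 $ (T - {i}) else 0)" for T
    by (simp add: finite_code)
  then show ?thesis by (auto simp: vec_eq_iff axis_def)
qed

lemma wedge_list_ordered: "wedge_list (map (\<lambda>i. axis i 1) (ordered_list S)) = axis S 1"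
proof -
  have "wedge_list (map (\<lambda>i. axis i 1) l) = axis (set l) 1" if "to_nat_sorted l" for l :: "'a list"
    using that
  proof (induction l)
    case (Cons a l)
    have "a \<notin> set l" using Cons.prems by auto
    moreover have "shuffle_sign {a} (set l) = 1"
      unfolding shuffle_sign_def using Cons.prems by (intro prod.neutral ballI) auto
    ultimately show ?case using Cons by (simp add: ext_vec_axis_wedge_axis)
  qed (simp add: ext_one_def)
  from this[OF to_nat_sorted_ordered_list[of S]] show ?thesis by simp
qed

lemma ext_map_add: "ext_map f (x + y) = ext_map f x + ext_map f y"
  by (simp add: ext_map_def vec.scale_left_distrib sum.distrib)

lemma ext_map_scale: "ext_map f (c *s x) = c *s ext_map f x"
  by (simp add: ext_map_def vec.scale_sum_right)

lemma ext_map_zero [simp]: "ext_map f 0 = 0"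
  by (simp add: ext_map_def)

lemma ext_map_sum: "ext_map f (\<Sum>i\<in>I. g i) = (\<Sum>i\<in>I. ext_map f (g i))"
  by (induction I rule: infinite_finite_induct) (auto simp: ext_map_add)

lemma ext_map_axis:
  "ext_map f (axis S 1) = wedge_list (map (\<lambda>i. f (axis i 1)) (ordered_list S))"
proof -
  have "ext_map f (axis S 1) =
      (\<Sum>T\<in>UNIV. if T = S then wedge_list (map (\<lambda>i. f (axis i 1)) (ordered_list S)) else 0)"
    unfolding ext_map_def by (intro sum.cong) (auto simp: axis_def)
  then show ?thesis by simp
qed

lemma ext_map_one [simp]: "ext_map f ext_one = ext_one"
proof -
  have "ext_map f (axis {} 1) = ext_one"
    by (simp add: ext_map_axis)
  then show ?thesis by (simp add: ext_one_def)
qed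

lemma ext_vec_sum: "ext_vec (\<Sum>i\<in>I. c i *s u i) = (\<Sum>i\<in>I. c i *s ext_vec (u i))"
proof (induction I rule: infinite_finite_induct)
  case (insert i I)
  then show ?case by (simp add: ext_vec_add ext_vec_scale)
qed (simp_all add: ext_vec_def)

lemma ext_map_ext_vec_wedge:
  assumes "Vector_Spaces.linear (*s) (*s) f"
  shows "ext_map f (ext_vec u \<and>\<^sub>E y) = ext_vec (f u) \<and>\<^sub>E ext_map f y"
proof -
  interpret f: Vector_Spaces.linear "(*s)" "(*s)" f by fact
  have fu: "f u = (\<Sum>i\<in>UNIV. u $ i *s f (axis i 1))"
    using arg_cong[OF basis_expansion[of u], of f] by (simp add: f.sum f.scale)
  have u: "ext_vec u = (\<Sum>i\<in>UNIV. u $ i *s ext_vec (axis i 1))"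
    using ext_vec_sum[of "\<lambda>i. u $ i" "\<lambda>i. axis i 1" UNIV] by (simp add: basis_expansion)
  have y: "y = (\<Sum>S\<in>UNIV. y $ S *s axis S 1)" by (simp add: basis_expansion)
  have *: "ext_map f (ext_vec (axis i 1) \<and>\<^sub>E axis S 1) =
      ext_vec (f (axis i 1)) \<and>\<^sub>E ext_map f (axis S 1)" for i S
    using wedge_ordered_insert[of "\<lambda>i. f (axis i 1)" i S]
    by (simp add: ext_vec_axis_wedge_axis ext_map_axis ext_map_scale)
  show ?thesis
    unfolding fu ext_vec_sum
    by (subst (1 2) y, subst u)
      (simp add: wedge_sum_left wedge_sum_right wedge_scale_left wedge_scale_right
        ext_map_sum ext_map_scale *)
qed

lemma ext_map_wedge:
  assumes "Vector_Spaces.linear (*s) (*s) f"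
  shows "ext_map f (x \<and>\<^sub>E y) = ext_map f x \<and>\<^sub>E ext_map f y"
proof -
  have "ext_map f (wedge_list us \<and>\<^sub>E y) = wedge_list (map f us) \<and>\<^sub>E ext_map f y" for us
    by (induction us) (simp_all add: wedge_assoc ext_map_ext_vec_wedge[OF assms])
  then have *: "ext_map f (axis S 1 \<and>\<^sub>E y) = ext_map f (axis S 1) \<and>\<^sub>E ext_map f y" for S
    unfolding ext_map_axis by (subst wedge_list_ordered[symmetric]) (simp add: comp_def)
  show ?thesis
    by (subst (1 2) basis_expansion[of x, symmetric])
      (simp add: wedge_sum_left wedge_scale_left ext_map_sum ext_map_scale *)
qed

lemma ext_map_ext_vec:
  assumes "Vector_Spaces.linear (*s) (*s) f"
  shows "ext_map f (ext_vec u) = ext_vec (f u)"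
  using ext_map_ext_vec_wedge[OF assms, of u ext_one] by simp

definition contract :: "complex ^ 'n \<Rightarrow> 'n::finite ext \<Rightarrow> 'n ext" where
  "contract u y = (\<chi> S. \<Sum>i\<in>- S. cnj (u $ i) * shuffle_sign {i} S * y $ insert i S)"

lemma ext_inner_wedge_left: "ext_inner (ext_vec u \<and>\<^sub>E x) y = ext_inner x (contract u y)"
proof -
  have "ext_inner (ext_vec u \<and>\<^sub>E x) y = (\<Sum>(S, i)\<in>Sigma UNIV (\<lambda>S. S).
      u $ i * shuffle_sign {i} (S - {i}) * x $ (S - {i}) * cnj (y $ S))"
    by (subst sum.Sigma[symmetric])
      (simp_all add: ext_inner_def ext_vec_wedge_nth sum_distrib_right)
  also have "\<dots> = (\<Sum>(S, i)\<in>Sigma UNIV (\<lambda>S. - S).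
      u $ i * shuffle_sign {i} S * x $ S * cnj (y $ insert i S))"
    by (rule sum.reindex_bij_witness[where j = "\<lambda>(S, i). (S - {i}, i)" and i = "\<lambda>(S, i). (insert i S, i)"])
      (auto simp: insert_absorb)
  also have "\<dots> = ext_inner x (contract u y)"
    by (subst sum.Sigma[symmetric])
      (simp_all add: ext_inner_def contract_def sum_distrib_left mult_ac)
  finally show ?thesis .
qed

lemma contract_ext_vec_wedge:
  "contract u (ext_vec w \<and>\<^sub>E y) = cinner w u *s y - ext_vec w \<and>\<^sub>E contract u y"
proof (subst vec_eq_iff, intro allI)
  fix S
  define G where "G i j = cnj (u $ i) * w $ j * shuffle_sign {i} S *
    shuffle_sign {j} (insert i S - {j}) * y $ (insert i S - {j})" for i j
  define H where "H i j = cnj (u $ i) * w $ j * shuffle_sign {j} (S - {j}) *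
    shuffle_sign {i} (S - {j}) * y $ (insert i (S - {j}))" for i j
  have GH: "G i j = - H i j" if ij: "i \<notin> S" "j \<in> S" for i j
  proof -
    define T where "T = S - {j}"
    have T: "S = insert j T" "i \<notin> T" "j \<notin> T" "i \<noteq> j" using ij by (auto simp: T_def)
    have *: "insert i S - {j} = insert i T" "S - {j} = T" using T by auto
    have "shuffle_sign {i} S = shuffle_sign {i} {j} * shuffle_sign {i} T"
      unfolding T(1) by (rule shuffle_sign_insert_right) (use T in auto)
    moreover have "shuffle_sign {j} (insert i T) = shuffle_sign {j} {i} * shuffle_sign {j} T"
      by (rule shuffle_sign_insert_right) (use T in auto)
    ultimately show ?thesis
      unfolding G_def H_def * using shuffle_sign_swap[OF T(4)] by simp
  qed
  have "contract u (ext_vec w \<and>\<^sub>E y) $ S = (\<Sum>i\<in>-S. \<Sum>j\<in>insert i S. G i j)"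
    unfolding contract_def ext_vec_wedge_nth G_def sum_distrib_left vec_lambda_beta
    by (simp only: mult_ac)
  also have "\<dots> = (\<Sum>i\<in>-S. G i i + (\<Sum>j\<in>S. G i j))"
    by (intro sum.cong) auto
  also have "\<dots> = (\<Sum>i\<in>-S. cnj (u $ i) * w $ i * y $ S) - (\<Sum>i\<in>-S. \<Sum>j\<in>S. H i j)"
    unfolding sum.distrib by (simp add: GH sum_negf) (simp add: G_def mult_ac)
  also have "(\<Sum>i\<in>-S. \<Sum>j\<in>S. H i j) = (\<Sum>j\<in>S. \<Sum>i\<in>-S. H i j)"
    by (rule sum.swap)
  also have "(\<Sum>j\<in>S. \<Sum>i\<in>-S. H i j) = (\<Sum>j\<in>S. \<Sum>i\<in>- (S - {j}). H i j) - (\<Sum>j\<in>S. H j j)"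
  proof -
    have "(\<Sum>i\<in>- (S - {j}). H i j) = H j j + (\<Sum>i\<in>-S. H i j)" if "j \<in> S" for j
    proof -
      have "- (S - {j}) = insert j (- S)" using that by auto
      then show ?thesis using that by simp
    qed
    then show ?thesis by (simp add: sum.distrib)
  qed
  also have "(\<Sum>j\<in>S. \<Sum>i\<in>- (S - {j}). H i j) = (ext_vec w \<and>\<^sub>E contract u y) $ S"
    unfolding contract_def ext_vec_wedge_nth H_def sum_distrib_left vec_lambda_beta
    by (simp only: mult_ac)
  also have "(\<Sum>j\<in>S. H j j) = (\<Sum>j\<in>S. cnj (u $ j) * w $ j * y $ S)"
    by (intro sum.cong) (auto simp: H_def insert_absorb mult_ac)
  also have "(\<Sum>i\<in>-S. cnj (u $ i) * w $ i * y $ S) -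
      ((ext_vec w \<and>\<^sub>E contract u y) $ S - (\<Sum>j\<in>S. cnj (u $ j) * w $ j * y $ S)) =
      (\<Sum>i\<in>UNIV. cnj (u $ i) * w $ i * y $ S) - (ext_vec w \<and>\<^sub>E contract u y) $ S"
    using sum.union_disjoint[of "- S" S "\<lambda>i. cnj (u $ i) * w $ i * y $ S"] by simp
  finally show "contract u (ext_vec w \<and>\<^sub>E y) $ S =
      (cinner w u *s y - ext_vec w \<and>\<^sub>E contract u y) $ S"
    by (simp add: cinner_def sum_distrib_right mult.commute[of "w $ _"])
qed

lemma contract_one [simp]: "contract u ext_one = 0"
  by (auto simp: contract_def ext_one_def axis_def vec_eq_iff)

lemma wedge_contract_list:
  assumes "distinct l"
  shows "ext_vec x \<and>\<^sub>E contract u (wedge_list (map w l)) =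
    (\<Sum>b\<in>set l. cinner (w b) u *s wedge_list (map (w(b := x)) l))"
  using assms
proof (induction l)
  case (Cons a l)
  have upd: "(w(b := x)) a = w a" if "b \<in> set l" for b
    using that Cons.prems by auto
  have "ext_vec x \<and>\<^sub>E contract u (wedge_list (map w (a # l))) =
      cinner (w a) u *s (ext_vec x \<and>\<^sub>E wedge_list (map w l)) +
      ext_vec (w a) \<and>\<^sub>E (ext_vec x \<and>\<^sub>E contract u (wedge_list (map w l)))"
    using ext_vec_anticommute'[of x "w a"] wedge_add_right[of "ext_vec x" _ "- _"]
    by (simp add: contract_ext_vec_wedge wedge_scale_right wedge_minus_right)
  also have "ext_vec x \<and>\<^sub>E wedge_list (map w l) = wedge_list (map (w(a := x)) (a # l))"
  proof -
    have "map w l = map (w(a := x)) l" using Cons.prems by auto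
    then show ?thesis by (simp only: list.map wedge_list_Cons fun_upd_same)
  qed
  also have "ext_vec (w a) \<and>\<^sub>E (ext_vec x \<and>\<^sub>E contract u (wedge_list (map w l))) =
      (\<Sum>b\<in>set l. cinner (w b) u *s wedge_list (map (w(b := x)) (a # l)))"
    using Cons upd by (auto simp: wedge_sum_right wedge_scale_right simp del: fun_upd_apply intro!: sum.cong)
  finally show ?case using Cons.prems by (simp del: fun_upd_apply)
qed simp

lemma ext_inner_diff_right: "ext_inner x (y - z) = ext_inner x y - ext_inner x z"
  by (simp add: ext_inner_def algebra_simps sum_subtractf)

lemma ext_inner_add_right: "ext_inner x (y + z) = ext_inner x y + ext_inner x z"
  by (simp add: ext_inner_def algebra_simps sum.distrib)

lemma ext_inner_scale_right: "ext_inner x (c *s y) = cnj c * ext_inner x y"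
  by (simp add: ext_inner_def sum_distrib_left mult_ac)

lemma ext_inner_sum_right: "ext_inner x (\<Sum>i\<in>I. f i) = (\<Sum>i\<in>I. ext_inner x (f i))"
proof (induction I rule: infinite_finite_induct)
  case (insert i I)
  then show ?case by (simp add: ext_inner_add_right)
qed (simp_all add: ext_inner_def)

lemma cnj_cinner: "cnj (cinner u w) = cinner w u"
  by (simp add: cinner_def mult.commute)

lemma ext_inner_wedge_list_aux:
  fixes u w :: "'i \<Rightarrow> complex ^ 'n::finite"
  assumes "distinct l"
  shows "ext_inner (wedge_list (map u l)) (wedge_list (map w l)) =
    (\<Sum>\<sigma> | \<sigma> permutes set l. of_int (sign \<sigma>) * (\<Prod>i\<in>set l. cinner (u i) (w (\<sigma> i))))"
  using assms
proof (induction l arbitrary: w)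
  case Nil
  have "ext_inner ext_one (ext_one :: 'n ext) = (\<Sum>S\<in>UNIV. if S = ({} :: 'n set) then 1 else 0)"
    unfolding ext_inner_def by (intro sum.cong) (auto simp: ext_one_def axis_def)
  then show ?case by (simp add: sign_id)
next
  case (Cons a l)
  define T where "T b = Transposition.transpose a b" for b
  define N where "N w = (\<Sum>\<sigma> | \<sigma> permutes set l. of_int (sign \<sigma>) * (\<Prod>i\<in>set l. cinner (u i) (w (\<sigma> i))))"
    for w
  have al: "a \<notin> set l" and IH: "\<And>w. ext_inner (wedge_list (map u l)) (wedge_list (map w l)) = N w"
    using Cons unfolding N_def by auto
  have upd: "map (w(b := w a)) l = map (w \<circ> T b) l" if "b \<in> set l" for b
    using that al by (auto simp: T_def Transposition.transpose_def)
  have "ext_inner (wedge_list (map u (a # l))) (wedge_list (map w (a # l))) =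
      cinner (u a) (w a) * N w -
      (\<Sum>b\<in>set l. cinner (u a) (w b) * ext_inner (wedge_list (map u l)) (wedge_list (map (w(b := w a)) l)))"
    using Cons.prems
    by (simp add: ext_inner_wedge_left contract_ext_vec_wedge wedge_contract_list IH
        ext_inner_diff_right ext_inner_scale_right ext_inner_sum_right cnj_cinner del: fun_upd_apply)
  also have "\<dots> = cinner (u a) (w a) * N w - (\<Sum>b\<in>set l. cinner (u a) (w b) * N (w \<circ> T b))"
    by (intro arg_cong2[where f = "(-)"] sum.cong refl) (simp add: upd IH del: fun_upd_apply)
  also have "\<dots> = (\<Sum>b\<in>set (a # l). (if a = b then 1 else - 1) * cinner (u a) (w b) * N (w \<circ> T b))"
  proof -
    have "w \<circ> T a = w" by (auto simp: T_def)
    moreover have "(\<Sum>b\<in>set l. (if a = b then 1 else - 1) * cinner (u a) (w b) * N (w \<circ> T b)) =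
      (\<Sum>b\<in>set l. - (cinner (u a) (w b) * N (w \<circ> T b)))"
      using al by (intro sum.cong) auto
    ultimately show ?thesis using al by (simp add: sum_negf)
  qed
  also have "\<dots> = (\<Sum>b\<in>insert a (set l). \<Sum>q | q permutes set l.
      of_int (sign (Transposition.transpose a b \<circ> q)) *
      (\<Prod>i\<in>set (a # l). cinner (u i) (w ((Transposition.transpose a b \<circ> q) i))))"
  proof (intro sum.cong)
    fix b assume "b \<in> insert a (set l)"
    have "(if a = b then 1 else - 1) * cinner (u a) (w b) *
        (of_int (sign q) * (\<Prod>i\<in>set l. cinner (u i) ((w \<circ> T b) (q i)))) =
      of_int (sign (Transposition.transpose a b \<circ> q)) *
        (\<Prod>i\<in>set (a # l). cinner (u i) (w ((Transposition.transpose a b \<circ> q) i)))" if "q permutes set l" for q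
    proof -
      have "permutation q" using that permutation_permutes by blast
      then have "sign (Transposition.transpose a b \<circ> q) = (if a = b then 1 else - 1) * sign q"
        by (simp add: sign_compose permutation_swap_id sign_swap_id)
      moreover have "q a = a" using that al by (simp add: permutes_not_in)
      ultimately show ?thesis using al by (simp add: T_def)
    qed
    then show "(if a = b then 1 else - 1) * cinner (u a) (w b) * N (w \<circ> T b) =
      (\<Sum>q | q permutes set l. of_int (sign (Transposition.transpose a b \<circ> q)) *
        (\<Prod>i\<in>set (a # l). cinner (u i) (w ((Transposition.transpose a b \<circ> q) i))))"
      unfolding N_def sum_distrib_left by (intro sum.cong) auto
  qed auto
  also have "\<dots> = (\<Sum>\<sigma> | \<sigma> permutes set (a # l).
      of_int (sign \<sigma>) * (\<Prod>i\<in>set (a # l). cinner (u i) (w (\<sigma> i))))"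
    using sum_over_permutations_insert[OF finite_set al,
      of "\<lambda>\<sigma>. of_int (sign \<sigma>) * (\<Prod>i\<in>set (a # l). cinner (u i) (w (\<sigma> i)))"] by simp
  finally show ?case .
qed

lemma ext_inner_wedge_list:
  fixes u w :: "nat \<Rightarrow> complex ^ 'n::finite"
  shows "ext_inner (wedge_list (map u [0..<p])) (wedge_list (map w [0..<p])) =
    (\<Sum>\<sigma> | \<sigma> permutes {0..<p}. of_int (sign \<sigma>) * (\<Prod>i\<in>{0..<p}. cinner (u i) (w (\<sigma> i))))"
  using ext_inner_wedge_list_aux[of "[0..<p]" u w] by simp

section \<open>The third symmetric power of \<open>\<complex>\<^sup>3\<close>\<close>

text \<open>
  In the numeral type \<open>3\<close> one has \<open>3 = 0\<close>, so \<open>axis 1 1\<close>, \<open>axis 2 1\<close>, \<open>axis 3 1\<close> are the three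
  distinct standard basis vectors. The coordinate at \<open>(i, j, k)\<close> of an element of
  \<open>V \<otimes> V \<otimes> V\<close> is the coefficient of \<open>e\<^sub>i \<otimes> e\<^sub>j \<otimes> e\<^sub>k\<close>.
\<close>

type_synonym tensor3 = "complex ^ (3 \<times> 3 \<times> 3)"

definition tensor :: "complex ^ 3 \<Rightarrow> complex ^ 3 \<Rightarrow> complex ^ 3 \<Rightarrow> tensor3" where
  "tensor x y z = (\<chi> p. case p of (i, j, k) \<Rightarrow> x $ i * y $ j * z $ k)"

definition tensor_action :: "complex ^ 3 ^ 3 \<Rightarrow> tensor3 \<Rightarrow> tensor3" where
  "tensor_action g t = (\<Sum>(i, j, k)\<in>UNIV. t $ (i, j, k) *s
     tensor (g *v axis i 1) (g *v axis j 1) (g *v axis k 1))"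

definition sym_prod :: "3 \<Rightarrow> 3 \<Rightarrow> 3 \<Rightarrow> tensor3" where
  "sym_prod i\<^sub>1 i\<^sub>2 i\<^sub>3 = (let i = vector [i\<^sub>1, i\<^sub>2, i\<^sub>3] :: 3 ^ 3 in
     (1 / fact 3) *s (\<Sum>\<sigma> | \<sigma> permutes (UNIV :: 3 set).
       tensor (axis (i $ \<sigma> 1) 1) (axis (i $ \<sigma> 2) 1) (axis (i $ \<sigma> 3) 1)))"

definition symmetrize :: "tensor3 \<Rightarrow> tensor3" where
  "symmetrize t = (\<Sum>(i, j, k)\<in>UNIV. t $ (i, j, k) *s sym_prod i j k)"

definition S3V :: "tensor3 set" where
  "S3V = range symmetrize"

definition S3V_basis :: "nat \<Rightarrow> tensor3" where
  "S3V_basis n =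
    [sym_prod 1 1 1, sym_prod 2 2 2, sym_prod 3 3 3, sym_prod 1 1 2, sym_prod 1 1 3,
     sym_prod 2 2 3, sym_prod 1 2 2, sym_prod 1 3 3, sym_prod 2 3 3, sym_prod 1 2 3] ! (n - 1)"

definition monomial :: "nat list \<Rightarrow> (3 \<times> 3 \<times> 3) ext" where
  "monomial ns = wedge_list (map S3V_basis ns)"

definition sl3_invariants :: "(3 \<times> 3 \<times> 3) ext set" where
  "sl3_invariants =
    {x \<in> ext_algebra S3V. \<forall>g :: complex ^ 3 ^ 3. det g = 1 \<longrightarrow> ext_map (tensor_action g) x = x}"

definition hodge_dual :: "(3 \<times> 3 \<times> 3) ext \<Rightarrow> (3 \<times> 3 \<times> 3) ext \<Rightarrow> (3 \<times> 3 \<times> 3) ext" where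
  "hodge_dual vol x = (THE y. y \<in> ext_power 7 S3V \<and>
     (\<forall>u\<in>ext_power 3 S3V. u \<and>\<^sub>E y = ext_inner u x *s vol))"

lemma linear_tensor_action: "Vector_Spaces.linear (*s) (*s) (tensor_action g)"
  by unfold_locales
    (auto simp: tensor_action_def vec.scale_sum_right vec.scale_left_distrib sum.distrib
      case_prod_unfold)

lemma tensor_action_tensor:
  "tensor_action g (tensor x y z) = tensor (g *v x) (g *v y) (g *v z)"
proof -
  have *: "(g *v axis j 1) $ i = g $ i $ j" for i j
    by (simp add: matrix_vector_mult_def axis_def if_distrib cong: if_cong)
  have **: "tensor (g *v axis i 1) (g *v axis j 1) (g *v axis k 1) $ (a, b, c) =
      g $ a $ i * g $ b $ j * g $ c $ k" for i j k a b c
    by (simp add: tensor_def *)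
  have "tensor_action g (tensor x y z) $ (a, b, c) = tensor (g *v x) (g *v y) (g *v z) $ (a, b, c)"
    for a b c
  proof -
    have "tensor_action g (tensor x y z) $ (a, b, c) = (\<Sum>i\<in>UNIV. \<Sum>j\<in>UNIV. \<Sum>k\<in>UNIV.
        x $ i * y $ j * z $ k * (g $ a $ i * g $ b $ j * g $ c $ k))"
      unfolding tensor_action_def UNIV_Times_UNIV[symmetric] sum.cartesian_product[symmetric]
      by (simp add: ** ) (simp add: tensor_def)
    also have "\<dots> = (\<Sum>i\<in>UNIV. g $ a $ i * x $ i) * ((\<Sum>j\<in>UNIV. g $ b $ j * y $ j) *
        (\<Sum>k\<in>UNIV. g $ c $ k * z $ k))"
      unfolding sum_product by (simp only: sum_distrib_left) (simp only: mult_ac)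
    finally show ?thesis by (simp add: tensor_def matrix_vector_mult_def)
  qed
  then show ?thesis by (auto simp: vec_eq_iff)
qed

end

theory Submission
  imports Defs
begin

text \<open>
  Invariance under \<open>SL(3)\<close> is turned into linear algebra on \<open>\<Lambda>(S\<^sup>3V)\<close>, where the Lie algebra acts by
  derivations. Differentiating a curve in \<open>SL(3)\<close> through the identity shows that \<open>sl(3)\<close> kills every
  invariant. Conversely an element killed by all \<open>E\<^sub>a\<^sub>b\<close> with \<open>a \<noteq> b\<close> is fixed by the one-parameter
  groups \<open>1 + s E\<^sub>a\<^sub>b\<close>, and these transvections generate \<open>SL(3)\<close>
  (\<open>ext_map_one_parameter_group\<close>, \<open>SL3_transvection_induct\<close>,
  \<open>SL3_invariant_if_root_derivations_vanish\<close>). So the invariance of \<open>v\<close> and of \<open>*v\<close> is the finite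
  check that \<open>E\<^sub>a\<^sub>b v = E\<^sub>a\<^sub>b (*v) = 0\<close> (\<open>raise_invariant3\<close>, \<open>raise_invariant7\<close>).

  That nothing else is invariant is seen by duality. The wedge monomials \<open>a\<^sub>L\<close>, \<open>L\<close> a subset of
  \<open>{1..10}\<close>, are an orthogonal basis of \<open>\<Lambda>(S\<^sup>3V)\<close>, and \<open>E\<^sub>a\<^sub>b\<close> and \<open>E\<^sub>b\<^sub>a\<close> are adjoint, so an invariant
  \<open>x\<close> is orthogonal to every \<open>E\<^sub>a\<^sub>b z\<close> with \<open>a \<noteq> b\<close>. The diagonal part of \<open>sl(3)\<close> makes \<open>x\<close>
  orthogonal to each \<open>a\<^sub>L\<close> in which the letters \<open>1\<close>, \<open>2\<close>, \<open>3\<close> do not occur equally often. Of the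
  1024 monomials 64 remain, and for 60 of these a single relation
  \<open>E\<^sub>a\<^sub>b a\<^sub>T = c a\<^sub>S + (monomials treated before)\<close> with \<open>c \<noteq> 0\<close> expresses \<open>\<langle>a\<^sub>S, x\<rangle>\<close> through earlier
  inner products; the relations are listed in \<open>elimination_table\<close>. Hence \<open>x\<close> is determined by its inner
  products with the four monomials \<open>1\<close>, \<open>a\<^sub>1 \<and> a\<^sub>2 \<and> a\<^sub>3\<close>, \<open>a\<^sub>4 \<and> \<dots> \<and> a\<^sub>1\<^sub>0\<close> and \<open>a\<^sub>1 \<and> \<dots> \<and> a\<^sub>1\<^sub>0\<close>
  (\<open>SL3_invariant_orthogonal\<close>). The four invariants \<open>1\<close>, \<open>v\<close>, \<open>*v\<close> and \<open>vol\<close> realise all values of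
  these inner products, so they span the invariants, and \<open>vol\<close> is a multiple of \<open>v \<and> *v = \<langle>v, v\<rangle> vol\<close>.

  The formula for \<open>*v\<close> holds term by term: for complementary \<open>I\<close> and \<open>J\<close> one has
  \<open>a\<^sub>I \<and> a\<^sub>J = \<plusminus>vol\<close>, so the dual of \<open>a\<^sub>I\<close> is \<open>a\<^sub>J\<close> up to a sign and the factor \<open>\<langle>a\<^sub>I, a\<^sub>I\<rangle>\<close>, which is a
  product of the squared norms \<open>1\<close>, \<open>1/3\<close> and \<open>1/6\<close> of the basis vectors (\<open>wedge_hodge_term\<close>).
\<close>

section \<open>Derivations of the exterior algebra\<close>

lemma wedge_list_append: "wedge_list (us @ ws) = wedge_list us \<and>\<^sub>E wedge_list ws"
  by (induction us) (simp_all add: wedge_assoc)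

lemma ext_map_wedge_list:
  assumes "Vector_Spaces.linear (*s) (*s) f"
  shows "ext_map f (wedge_list us) = wedge_list (map f us)"
  by (induction us) (simp_all add: ext_map_ext_vec_wedge[OF assms])

lemma ext_map_compose:
  assumes "Vector_Spaces.linear (*s) (*s) f"
  shows "ext_map f (ext_map g x) = ext_map (\<lambda>u. f (g u)) x"
  unfolding ext_map_def[of g x] ext_map_def[of "\<lambda>u. f (g u)"] ext_map_sum ext_map_scale
    ext_map_wedge_list[OF assms] by (simp add: comp_def)

lemma ext_map_ident: "ext_map (\<lambda>u. u) x = x"
  by (simp add: ext_map_def wedge_list_ordered basis_expansion)

lemma ext_inner_cnj: "cnj (ext_inner x y) = ext_inner y x"
  by (simp add: ext_inner_def mult.commute)

lemma ext_inner_add_left: "ext_inner (x + y) z = ext_inner x z + ext_inner y z"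
  by (simp add: ext_inner_def algebra_simps sum.distrib)

lemma ext_inner_scale_left: "ext_inner (c *s x) z = c * ext_inner x z"
  by (simp add: ext_inner_def sum_distrib_left mult_ac)

lemma ext_inner_zero [simp]: "ext_inner 0 z = 0" "ext_inner z 0 = 0"
  by (simp_all add: ext_inner_def)

lemma ext_inner_sum_left: "ext_inner (\<Sum>i\<in>I. f i) z = (\<Sum>i\<in>I. ext_inner (f i) z)"
  by (induction I rule: infinite_finite_induct) (simp_all add: ext_inner_add_left)

lemma ext_inner_contract_left: "ext_inner (contract u x) y = ext_inner x (ext_vec u \<and>\<^sub>E y)"
  using arg_cong[OF ext_inner_wedge_left[of u y x], of cnj] by (simp add: ext_inner_cnj)

lemma ext_inner_self_eq_0:
  assumes "ext_inner x x = 0"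
  shows "x = 0"
proof -
  have "ext_inner x x = of_real (\<Sum>S\<in>UNIV. (cmod (x $ S))\<^sup>2)"
    by (simp add: ext_inner_def complex_norm_square del: of_real_power)
  then have "(\<Sum>S\<in>UNIV. (cmod (x $ S))\<^sup>2) = 0"
    using assms by (metis of_real_eq_0_iff)
  then have "\<forall>S. (cmod (x $ S))\<^sup>2 = 0"
    by (subst (asm) sum_nonneg_eq_0_iff) auto
  then show ?thesis by (simp add: vec_eq_iff)
qed

lemma cinner_axis: "cinner w (axis i 1) = w $ i"
  by (simp add: cinner_def axis_def if_distrib[of cnj] if_distrib[of "(*) _"] cong: if_cong)

lemma cinner_add_right: "cinner u (w + w') = cinner u w + cinner u w'"
  by (simp add: cinner_def algebra_simps sum.distrib)

lemma cinner_scale_right: "cinner u (c *s w) = cnj c * cinner u w"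
  by (simp add: cinner_def sum_distrib_left algebra_simps)

lemma contract_add: "contract u (x + y) = contract u x + contract u y"
  by (simp add: contract_def vec_eq_iff algebra_simps sum.distrib)

lemma contract_scale: "contract u (c *s x) = c *s contract u x"
  by (simp add: contract_def vec_eq_iff sum_distrib_left algebra_simps)

lemma contract_basis_expansion:
  "contract u x = (\<Sum>i\<in>UNIV. cnj (u $ i) *s contract (axis i 1) x)"
proof -
  have "(\<Sum>i\<in>UNIV. cnj (u $ i) *s contract (axis i 1) x) $ S = contract u x $ S" for S
  proof -
    have "(\<Sum>i\<in>UNIV. cnj (u $ i) *s contract (axis i 1) x) $ S =
        (\<Sum>i\<in>UNIV. \<Sum>j\<in>-S. if j = i then cnj (u $ i) * shuffle_sign {i} S * x $ insert i S else 0)"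
      by (simp add: contract_def sum_distrib_left axis_def if_distrib[of cnj] if_distribR
          if_distrib[of "\<lambda>c. c * _"] mult.assoc cong: if_cong) (intro sum.cong refl, auto)
    also have "\<dots> = (\<Sum>j\<in>-S. \<Sum>i\<in>UNIV. if j = i then cnj (u $ i) * shuffle_sign {i} S * x $ insert i S else 0)"
      by (rule sum.swap)
    finally show ?thesis by (simp add: contract_def)
  qed
  then show ?thesis by (simp add: vec_eq_iff)
qed

text \<open>
  The derivation of the exterior algebra that extends the endomorphism \<open>N\<close>. The sum over a basis of
  creation after annihilation is chosen because it is visibly well defined and linear, and because its
  adjoint can be read off.
\<close>

definition derivation :: "(complex ^ 'n \<Rightarrow> complex ^ 'n) \<Rightarrow> 'n::finite ext \<Rightarrow> 'n ext" where
  "derivation N x = (\<Sum>i\<in>UNIV. ext_vec (N (axis i 1)) \<and>\<^sub>E contract (axis i 1) x)"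

lemma derivation_add: "derivation N (x + y) = derivation N x + derivation N y"
  by (simp add: derivation_def contract_add wedge_add_right sum.distrib)

lemma derivation_scale: "derivation N (c *s x) = c *s derivation N x"
  by (simp add: derivation_def contract_scale wedge_scale_right vec.scale_sum_right)

lemma derivation_zero [simp]: "derivation N 0 = 0"
  using derivation_scale[of N 0 0] by simp

lemma derivation_sum: "derivation N (\<Sum>i\<in>I. f i) = (\<Sum>i\<in>I. derivation N (f i))"
  by (induction I rule: infinite_finite_induct) (auto simp: derivation_add)

lemma derivation_one [simp]: "derivation N ext_one = 0"
  by (simp add: derivation_def)

lemma derivation_scale_map: "derivation (\<lambda>u. c *s N u) x = c *s derivation N x"
  by (simp add: derivation_def ext_vec_scale wedge_scale_left vec.scale_sum_right)

lemma derivation_diff_map: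
  "derivation (\<lambda>u. N u - M u) x = derivation N x - derivation M x"
proof -
  have "ext_vec (u - w) = ext_vec u - ext_vec w" for u w :: "complex ^ 'a"
    by (metis add_diff_cancel diff_add_cancel ext_vec_add)
  moreover have "(y - z) \<and>\<^sub>E x = y \<and>\<^sub>E x - z \<and>\<^sub>E x" for x y z :: "'a ext"
    by (metis add_diff_cancel diff_add_cancel wedge_add_left)
  ultimately show ?thesis by (simp add: derivation_def sum_subtractf)
qed

lemma derivation_ext_vec_wedge:
  assumes "Vector_Spaces.linear (*s) (*s) N"
  shows "derivation N (ext_vec w \<and>\<^sub>E y) = ext_vec (N w) \<and>\<^sub>E y + ext_vec w \<and>\<^sub>E derivation N y"
proof -
  interpret N: Vector_Spaces.linear "(*s)" "(*s)" N by fact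
  have Nw: "N w = (\<Sum>i\<in>UNIV. w $ i *s N (axis i 1))"
    using arg_cong[OF basis_expansion[of w], of N] by (simp add: N.sum N.scale)
  have "derivation N (ext_vec w \<and>\<^sub>E y) =
      (\<Sum>i\<in>UNIV. (w $ i *s ext_vec (N (axis i 1))) \<and>\<^sub>E y +
        ext_vec w \<and>\<^sub>E ext_vec (N (axis i 1)) \<and>\<^sub>E contract (axis i 1) y)"
    unfolding derivation_def contract_ext_vec_wedge cinner_axis diff_conv_add_uminus wedge_add_right
      wedge_minus_right wedge_scale_right wedge_scale_left
    by (subst ext_vec_anticommute') simp
  then show ?thesis
    by (simp add: sum.distrib Nw ext_vec_sum wedge_sum_left wedge_sum_right derivation_def)
qed

text \<open>
  Creation and annihilation are adjoint, so passing to the adjoint in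
  \<open>\<Sum>\<^sub>i N e\<^sub>i \<and> \<iota>(e\<^sub>i)\<close> replaces the matrix of \<open>N\<close> by its conjugate transpose.
\<close>

lemma derivation_adjoint:
  assumes adj: "\<And>i j. N (axis i 1) $ j = cnj (M (axis j 1) $ i)"
  shows "ext_inner (derivation N x) y = ext_inner x (derivation M y)"
proof -
  let ?e = "\<lambda>i. axis i 1 :: complex ^ 'a"
  have NM: "cnj (M (?e j) $ i) = N (?e i) $ j" for i j
    by (simp add: adj)
  have "ext_inner (derivation N x) y =
      (\<Sum>i\<in>UNIV. \<Sum>j\<in>UNIV. N (?e i) $ j * ext_inner (contract (?e i) x) (contract (?e j) y))"
    unfolding derivation_def ext_inner_sum_left ext_inner_wedge_left
    by (subst (2) contract_basis_expansion) (simp add: ext_inner_sum_right ext_inner_scale_right)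
  also have "\<dots> = (\<Sum>j\<in>UNIV. \<Sum>i\<in>UNIV. N (?e i) $ j * ext_inner (contract (?e i) x) (contract (?e j) y))"
    by (rule sum.swap)
  also have "\<dots> = (\<Sum>j\<in>UNIV. ext_inner (contract (M (?e j)) x) (contract (?e j) y))"
    by (subst (3) contract_basis_expansion) (simp add: ext_inner_sum_left ext_inner_scale_left NM)
  also have "\<dots> = (\<Sum>j\<in>UNIV. ext_inner x (ext_vec (M (?e j)) \<and>\<^sub>E contract (?e j) y))"
    by (simp only: ext_inner_contract_left)
  also have "\<dots> = ext_inner x (derivation M y)"
    by (simp add: derivation_def ext_inner_sum_right)
  finally show ?thesis .
qed

lemma vec_scaleR_conv_scale: "r *\<^sub>R (x :: complex ^ 'n) = of_real r *s x"
  by (simp add: vec_eq_iff scaleR_conv_of_real[where 'a = complex] del: scaleR_conv_of_real)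

lemma bounded_bilinear_wedge: "bounded_bilinear (\<and>\<^sub>E)"
  unfolding bilinear_conv_bounded_bilinear[symmetric] bilinear_def
  by (auto intro!: linearI simp: wedge_add_left wedge_add_right wedge_scale_left
      wedge_scale_right vec_scaleR_conv_scale)

lemma bounded_linear_ext_vec: "bounded_linear ext_vec"
  unfolding linear_conv_bounded_linear[symmetric]
  by (auto intro!: linearI simp: ext_vec_add ext_vec_scale vec_scaleR_conv_scale)

text \<open>
  On a wedge of vectors this is the product rule for the bilinear wedge product, which at \<open>f 0 = 1\<close>
  reproduces the Leibniz rule \<open>derivation_ext_vec_wedge\<close>.
\<close>

lemma has_vector_derivative_ext_map:
  fixes f :: "real \<Rightarrow> complex ^ 'n::finite \<Rightarrow> complex ^ 'n"
  assumes N: "Vector_Spaces.linear (*s) (*s) N" and f0: "\<And>u. f 0 u = u"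
    and f: "\<And>u. ((\<lambda>s. f s u) has_vector_derivative N u) (at 0)"
  shows "((\<lambda>s. ext_map (f s) x) has_vector_derivative derivation N x) (at 0)"
proof -
  have *: "((\<lambda>s. wedge_list (map (f s) us)) has_vector_derivative derivation N (wedge_list us)) (at 0)"
    for us
  proof (induction us)
    case (Cons u us)
    have "((\<lambda>s. ext_vec (f s u)) has_vector_derivative ext_vec (N u)) (at 0)"
      by (rule bounded_linear.has_vector_derivative[OF bounded_linear_ext_vec f])
    from bounded_bilinear.has_vector_derivative[OF bounded_bilinear_wedge this Cons.IH]
    show ?case by (simp add: derivation_ext_vec_wedge[OF N] f0 add.commute)
  qed simp
  have "((\<lambda>s. \<Sum>S\<in>UNIV. x $ S *s wedge_list (map (\<lambda>i. f s (axis i 1)) (ordered_list S)))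
      has_vector_derivative (\<Sum>S\<in>UNIV. x $ S *s derivation N (axis S 1))) (at 0)"
  proof (intro has_vector_derivative_sum)
    fix S :: "'n set"
    have bl: "bounded_linear ((*s) (x $ S) :: 'n ext \<Rightarrow> 'n ext)"
      unfolding linear_conv_bounded_linear[symmetric]
      by (auto intro!: linearI simp: vec.scale_right_distrib vec_scaleR_conv_scale mult.commute)
    show "((\<lambda>s. x $ S *s wedge_list (map (\<lambda>i. f s (axis i 1)) (ordered_list S)))
      has_vector_derivative x $ S *s derivation N (axis S 1)) (at 0)"
      using bounded_linear.has_vector_derivative[OF bl *[of "map (\<lambda>i. axis i 1) (ordered_list S)"]]
      by (simp add: comp_def wedge_list_ordered)
  qed
  moreover have "(\<Sum>S\<in>UNIV. x $ S *s derivation N (axis S 1)) = derivation N x"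
    by (subst (2) basis_expansion[of x, symmetric]) (simp add: derivation_sum derivation_scale)
  ultimately show ?thesis by (simp add: ext_map_def)
qed

text \<open>
  The group law moves the derivative at any time \<open>t\<close> back to \<open>0\<close>, where it is \<open>derivation N x = 0\<close>;
  hence the orbit of \<open>x\<close> is constant.
\<close>

lemma ext_map_one_parameter_group:
  fixes f :: "real \<Rightarrow> complex ^ 'n::finite \<Rightarrow> complex ^ 'n"
  assumes lin: "\<And>s. Vector_Spaces.linear (*s) (*s) (f s)" and N: "Vector_Spaces.linear (*s) (*s) N"
    and f0: "\<And>u. f 0 u = u" and fadd: "\<And>s t u. f (s + t) u = f s (f t u)"
    and f: "\<And>u. ((\<lambda>s. f s u) has_vector_derivative N u) (at 0)"
    and x: "derivation N x = 0"
  shows "ext_map (f s) x = x"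
proof -
  have "((\<lambda>s. ext_map (f s) x) has_vector_derivative 0) (at t)" for t
  proof -
    have bl: "bounded_linear (ext_map (f t) :: 'n ext \<Rightarrow> 'n ext)"
      unfolding linear_conv_bounded_linear[symmetric]
      by (auto intro!: linearI simp: ext_map_add ext_map_scale vec_scaleR_conv_scale)
    have "((\<lambda>h. ext_map (f t) (ext_map (f h) x)) has_vector_derivative 0) (at 0)"
      using bounded_linear.has_vector_derivative[OF bl has_vector_derivative_ext_map[OF N f0 f, of x]] x
      by simp
    moreover have "f (t + h) = (\<lambda>u. f t (f h u))" for h using fadd by auto
    ultimately have "((\<lambda>h. ext_map (f (t + h)) x) has_vector_derivative 0) (at 0)"
      by (simp add: ext_map_compose[OF lin])
    then have "((\<lambda>h. ext_map (f (t + h)) x) has_vector_derivative 0) (at (t - t))" by simp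
    moreover have "((\<lambda>s. s - t) has_vector_derivative 1) (at t)"
      by (auto intro!: derivative_eq_intros)
    ultimately show ?thesis
      using vector_diff_chain_at[of "\<lambda>s. s - t" 1 t "\<lambda>h. ext_map (f (t + h)) x" 0]
      by (simp add: comp_def)
  qed
  then have "ext_map (f s) x = ext_map (f 0) x"
    by (metis UNIV_I convex_UNIV has_vector_derivative_zero_constant)
  moreover have "f 0 = (\<lambda>u. u)" using f0 by auto
  ultimately show ?thesis by (simp add: ext_map_ident)
qed

section \<open>Transvections generate the special linear group\<close>

definition transvection :: "'n \<Rightarrow> 'n \<Rightarrow> complex \<Rightarrow> complex ^ 'n ^ 'n" where
  "transvection a b c = (\<chi> i j. (if i = j then 1 else 0) + (if i = a \<and> j = b then c else 0))"

lemma transvection_mult_nth: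
  fixes A :: "complex ^ 'm ^ 'n::finite"
  shows "(transvection a b c ** A) $ i $ j = A $ i $ j + (if i = a then c * A $ b $ j else 0)"
  by (simp add: transvection_def matrix_matrix_mult_def algebra_simps sum.distrib
      if_distrib[of "\<lambda>x. _ * x"] if_distribR if_if_eq_conj[symmetric] cong: if_cong)

lemma mult_transvection_nth:
  fixes A :: "complex ^ 'n::finite ^ 'm"
  shows "(A ** transvection a b c) $ i $ j = A $ i $ j + (if j = b then A $ i $ a * c else 0)"
  by (simp add: transvection_def matrix_matrix_mult_def algebra_simps sum.distrib
      if_distrib[of "\<lambda>x. _ * x"] if_distribR if_if_eq_conj cong: if_cong)

lemma transvection_0 [simp]: "transvection a b 0 = mat 1"
  by (simp add: transvection_def mat_def vec_eq_iff)

lemma transvection_mult: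
  fixes a b :: "'n::finite"
  assumes "a \<noteq> b"
  shows "transvection a b c ** transvection a b d = transvection a b (c + d)"
  using assms by (auto simp: vec_eq_iff transvection_mult_nth) (auto simp: transvection_def)

lemma det_transvection:
  fixes a b :: 3
  assumes "a \<noteq> b"
  shows "det (transvection a b c) = 1"
  using assms exhaust_3[of a] exhaust_3[of b] by (auto simp: det_3 transvection_def)

text \<open>
  Gaussian elimination with row and column additions only. If some entry below the top left corner is
  nonzero, adding a multiple of its row to the first row turns the corner into \<open>1\<close>, after which the first
  row and column can be cleared. The same is done for the remaining block, and the last diagonal entry is
  then \<open>1\<close> because the determinant is. This is an induction rule in the direction needed for stabilisers:
  \<open>P\<close> passes from the reduced matrix back to the original one.
\<close>

lemma SL3_transvection_induct [consumes 1, case_names one left right]: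
  fixes A :: "complex ^ 3 ^ 3"
  assumes "det A = 1" and one: "P (mat 1)"
    and left: "\<And>a b c A. a \<noteq> b \<Longrightarrow> P (transvection a b c ** A) \<Longrightarrow> P A"
    and right: "\<And>a b c A. a \<noteq> b \<Longrightarrow> P (A ** transvection a b c) \<Longrightarrow> P A"
  shows "P A"
proof -
  note nth = transvection_mult_nth mult_transvection_nth
  note det = det_mul det_transvection
  (* Once the second pivot is 1, clearing its row and column gives the identity, as the determinant is 1. *)
  have lower: "P A" if "det A = 1" "A $ 1 $ 1 = 1" "A $ 1 $ 2 = 0" "A $ 1 $ 3 = 0"
    "A $ 2 $ 1 = 0" "A $ 3 $ 1 = 0" "A $ 2 $ 2 = 1" for A
  proof -
    define B where "B = (transvection 3 2 (- A $ 3 $ 2) ** A) ** transvection 2 3 (- A $ 2 $ 3)"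
    have "B = mat 1"
    proof -
      have "det B = 1" by (simp add: B_def det that)
      moreover have "B $ i $ j = mat 1 $ i $ j" if "i \<noteq> 3 \<or> j \<noteq> 3" for i j
        using that \<open>A $ 1 $ 1 = 1\<close> \<open>A $ 1 $ 2 = 0\<close> \<open>A $ 1 $ 3 = 0\<close> \<open>A $ 2 $ 1 = 0\<close>
          \<open>A $ 3 $ 1 = 0\<close> \<open>A $ 2 $ 2 = 1\<close> exhaust_3[of i] exhaust_3[of j]
        by (auto simp: B_def nth mat_def)
      ultimately have "B $ i $ j = mat 1 $ i $ j" for i j
        by (cases "i = 3 \<and> j = 3") (auto simp: det_3 mat_def)
      then show ?thesis by (simp add: vec_eq_iff)
    qed
    then have "P B" using one by simp
    then have "P (transvection 3 2 (- A $ 3 $ 2) ** A)"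
      unfolding B_def by (rule right[rotated]) simp
    then show ?thesis by (rule left[rotated]) simp
  qed
  have block: "P A" if "det A = 1" "A $ 1 $ 1 = 1" "A $ 1 $ 2 = 0" "A $ 1 $ 3 = 0"
    "A $ 2 $ 1 = 0" "A $ 3 $ 1 = 0" for A
  proof -
    have pivot: "P A" if "det A = 1" "A $ 1 $ 1 = 1" "A $ 1 $ 2 = 0" "A $ 1 $ 3 = 0"
      "A $ 2 $ 1 = 0" "A $ 3 $ 1 = 0" "A $ 3 $ 2 \<noteq> 0" for A
      by (rule left[of 2 3 "(1 - A $ 2 $ 2) / A $ 3 $ 2"], simp, rule lower)
        (use that in \<open>simp_all add: nth det\<close>)
    show ?thesis
    proof (cases "A $ 3 $ 2 = 0")
      case True
      then have "A $ 2 $ 2 \<noteq> 0" using that by (auto simp: det_3)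
      then show ?thesis
        by (intro left[of 3 2 1 A] pivot) (use that True in \<open>simp_all add: nth det\<close>)
    qed (rule pivot, use that in auto)
  qed
  have corner: "P A" if "det A = 1" "A $ 1 $ 1 = 1" for A
    by (rule left[of 2 1 "- A $ 2 $ 1"], simp, rule left[of 3 1 "- A $ 3 $ 1"], simp,
        rule right[of 1 2 _ "- A $ 1 $ 2"], simp, rule right[of 1 3 _ "- A $ 1 $ 3"], simp,
        rule block)
      (use that in \<open>simp_all add: nth det\<close>)
  have pivot: "P A" if "det A = 1" "A $ i $ 1 \<noteq> 0" "i \<noteq> 1" for A i
    by (rule left[of 1 i "(1 - A $ 1 $ 1) / A $ i $ 1"], (use that in simp), rule corner)
      (use that in \<open>simp_all add: nth det\<close>)
  show ?thesis
  proof (cases "A $ 2 $ 1 = 0 \<and> A $ 3 $ 1 = 0")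
    case True
    then have "A $ 1 $ 1 \<noteq> 0" using assms(1) by (auto simp: det_3)
    then show ?thesis
      by (intro left[of 2 1 1 A] pivot[of _ 2]) (use True assms(1) in \<open>simp_all add: nth det\<close>)
  next
    case False
    then show ?thesis using pivot[of A 2] pivot[of A 3] assms(1) by auto
  qed
qed

section \<open>From the group to its Lie algebra\<close>

lemma sum_if_const: "(\<Sum>k\<in>K. if P then f k else 0) = (if P then \<Sum>k\<in>K. f k else 0)"
  by simp

lemma has_vector_derivative_vecI:
  fixes F :: "real \<Rightarrow> complex ^ 'n::finite"
  assumes "\<And>p. ((\<lambda>s. F s $ p) has_vector_derivative D $ p) net"
  shows "(F has_vector_derivative D) net"
proof -
  have "((\<lambda>s. \<Sum>p\<in>UNIV. F s $ p *s axis p 1) has_vector_derivative (\<Sum>p\<in>UNIV. D $ p *s axis p (1::complex))) net"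
  proof (intro has_vector_derivative_sum)
    fix p :: 'n
    have bl: "bounded_linear (\<lambda>z. z *s axis p (1 :: complex))"
      unfolding linear_conv_bounded_linear[symmetric]
      by (auto intro!: linearI simp: vec.scale_left_distrib vec_scaleR_conv_scale scaleR_conv_of_real[where 'a = complex])
    show "((\<lambda>s. F s $ p *s axis p 1) has_vector_derivative D $ p *s axis p (1::complex)) net"
      by (rule bounded_linear.has_vector_derivative[OF bl assms])
  qed
  then show ?thesis by (simp add: basis_expansion)
qed

lemma tensor_action_nth:
  "tensor_action g t $ (a, b, c) = (\<Sum>i\<in>UNIV. \<Sum>j\<in>UNIV. \<Sum>k\<in>UNIV.
     g $ a $ i * g $ b $ j * g $ c $ k * t $ (i, j, k))"
proof -
  have *: "(g *v axis j 1) $ i = g $ i $ j" for i j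
    by (simp add: matrix_vector_mult_def axis_def if_distrib cong: if_cong)
  show ?thesis
    unfolding tensor_action_def UNIV_Times_UNIV[symmetric] sum.cartesian_product[symmetric]
    by (simp add: tensor_def *) (simp only: mult_ac)
qed

lemma axis_tensor: "axis (i, j, k) 1 = tensor (axis i 1) (axis j 1) (axis k 1)"
  by (auto simp: tensor_def axis_def vec_eq_iff)

lemma tensor_action_mult: "tensor_action (g ** h) t = tensor_action g (tensor_action h t)"
proof -
  interpret h: Vector_Spaces.linear "(*s)" "(*s)" "tensor_action h" by (rule linear_tensor_action)
  interpret g: Vector_Spaces.linear "(*s)" "(*s)" "tensor_action g" by (rule linear_tensor_action)
  interpret gh: Vector_Spaces.linear "(*s)" "(*s)" "tensor_action (g ** h)" by (rule linear_tensor_action)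
  have "tensor_action (g ** h) (axis p 1) = tensor_action g (tensor_action h (axis p 1))" for p
    by (cases p) (simp add: axis_tensor tensor_action_tensor matrix_vector_mul_assoc)
  then show ?thesis
    by (subst (1 2) basis_expansion[of t, symmetric]) (simp add: g.sum h.sum gh.sum g.scale h.scale gh.scale)
qed

lemma tensor_action_one: "tensor_action (mat 1) t = t"
  by (auto simp: vec_eq_iff tensor_action_nth mat_def if_distribR if_distrib[of "\<lambda>x. x * _"]
      sum_if_const cong: if_cong)

text \<open>
  The action of the matrix \<open>X\<close> as an element of the Lie algebra, that is
  \<open>X \<otimes> 1 \<otimes> 1 + 1 \<otimes> X \<otimes> 1 + 1 \<otimes> 1 \<otimes> X\<close>.
\<close>

definition tensor_derivation :: "complex ^ 3 ^ 3 \<Rightarrow> tensor3 \<Rightarrow> tensor3" where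
  "tensor_derivation X t = (\<chi> p. case p of (a, b, c) \<Rightarrow>
     \<Sum>i\<in>UNIV. X $ a $ i * t $ (i, b, c) + X $ b $ i * t $ (a, i, c) + X $ c $ i * t $ (a, b, i))"

lemma linear_tensor_derivation: "Vector_Spaces.linear (*s) (*s) (tensor_derivation X)"
  by unfold_locales
    (auto simp: tensor_derivation_def vec_eq_iff algebra_simps sum.distrib sum_distrib_left)

lemma tensor_derivation_tensor:
  "tensor_derivation X (tensor x y z) = tensor (X *v x) y z + tensor x (X *v y) z + tensor x y (X *v z)"
  by (auto simp: tensor_derivation_def tensor_def vec_eq_iff matrix_vector_mult_def sum.distrib
      sum_distrib_left sum_distrib_right mult_ac)

lemma tensor_derivation_axis_nth:
  "tensor_derivation X (axis (i, j, k) 1) $ (a, b, c) =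
     (if b = j \<and> c = k then X $ a $ i else 0) + (if a = i \<and> c = k then X $ b $ j else 0) +
     (if a = i \<and> b = j then X $ c $ k else 0)"
  by (auto simp: tensor_derivation_def axis_def sum.distrib if_distrib[of "\<lambda>x. _ * x"]
      if_if_eq_conj[symmetric] sum_if_const cong: if_cong)

lemma tensor_derivation_adjoint:
  "tensor_derivation X (axis p 1) $ q = cnj (tensor_derivation (\<chi> i j. cnj (X $ j $ i)) (axis q 1) $ p)"
  by (cases p; cases q) (auto simp: tensor_derivation_axis_nth)

text \<open>
  The entries of \<open>g \<otimes> g \<otimes> g\<close> are products of three entries of \<open>g\<close>, and the product rule at
  \<open>g 0 = 1\<close> leaves one factor \<open>X\<close> and two identity matrices in each summand.
\<close>

lemma has_vector_derivative_tensor_action: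
  assumes g0: "g 0 = mat 1"
    and g: "\<And>i j. ((\<lambda>s. g s $ i $ j) has_vector_derivative X $ i $ j) (at 0)"
  shows "((\<lambda>s. tensor_action (g s) t) has_vector_derivative tensor_derivation X t) (at 0)"
proof (rule has_vector_derivative_vecI)
  fix p :: "3 \<times> 3 \<times> 3"
  obtain a b c where p: "p = (a, b, c)" by (cases p)
  have "((\<lambda>s. tensor_action (g s) t $ (a, b, c)) has_vector_derivative
      (\<Sum>i\<in>UNIV. \<Sum>j\<in>UNIV. \<Sum>k\<in>UNIV.
        ((mat 1 $ a $ i * mat 1 $ b $ j) * X $ c $ k + (mat 1 $ a $ i * X $ b $ j + X $ a $ i * mat 1 $ b $ j) * mat 1 $ c $ k)
        * t $ (i, j, k))) (at 0)"
    unfolding tensor_action_nth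
    by (intro has_vector_derivative_sum has_vector_derivative_mult_left)
      (rule has_vector_derivative_eq_rhs, (rule has_vector_derivative_mult g)+, simp add: g0)
  also have "(\<Sum>i\<in>UNIV. \<Sum>j\<in>UNIV. \<Sum>k\<in>UNIV.
        ((mat 1 $ a $ i * mat 1 $ b $ j) * X $ c $ k + (mat 1 $ a $ i * X $ b $ j + X $ a $ i * mat 1 $ b $ j) * mat 1 $ c $ k)
        * t $ (i, j, k)) = tensor_derivation X t $ (a, b, c)"
    by (simp add: tensor_derivation_def mat_def if_distribR if_distrib[of "\<lambda>x. x * _"] 
       if_distrib[of "\<lambda>x. _ * x"] algebra_simps sum.distrib sum_if_const cong: if_cong)
  finally show "((\<lambda>s. tensor_action (g s) t $ p) has_vector_derivative tensor_derivation X t $ p) (at 0)"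
    by (simp add: p)
qed

definition matrix_unit :: "'n \<Rightarrow> 'n \<Rightarrow> complex ^ 'n ^ 'n" where
  "matrix_unit a b = (\<chi> i j. if i = a \<and> j = b then 1 else 0)"

text \<open>
  For \<open>a \<noteq> b\<close> the matrix unit \<open>E\<^sub>a\<^sub>b\<close> is a root vector of \<open>sl(3)\<close>. The case \<open>a = b\<close> is used for weights;
  only differences of these diagonal units lie in \<open>sl(3)\<close>.
\<close>

abbreviation root_derivation :: "3 \<Rightarrow> 3 \<Rightarrow> (3 \<times> 3 \<times> 3) ext \<Rightarrow> (3 \<times> 3 \<times> 3) ext" where
  "root_derivation a b \<equiv> derivation (tensor_derivation (matrix_unit a b))"

lemma root_derivation_adjoint:
  "ext_inner (root_derivation a b x) y = ext_inner x (root_derivation b a y)"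
proof -
  have "(\<chi> i j. cnj (matrix_unit a b $ j $ i)) = matrix_unit b a"
    by (auto simp: matrix_unit_def vec_eq_iff)
  then show ?thesis
    using derivation_adjoint tensor_derivation_adjoint by metis
qed

lemma root_derivation_wedge:
  "derivation (tensor_derivation X) (ext_vec u \<and>\<^sub>E y) =
     ext_vec (tensor_derivation X u) \<and>\<^sub>E y + ext_vec u \<and>\<^sub>E derivation (tensor_derivation X) y"
  by (rule derivation_ext_vec_wedge[OF linear_tensor_derivation])

lemma has_vector_derivative_transvection:
  "((\<lambda>s. transvection a b (of_real s * c) $ i $ j) has_vector_derivative c * matrix_unit a b $ i $ j) (at 0)"
  by (cases "i = a \<and> j = b")
    (auto simp: transvection_def matrix_unit_def intro!: derivative_eq_intros)

lemma ext_map_transvection: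
  assumes "a \<noteq> b" and x: "root_derivation a b x = 0"
  shows "ext_map (tensor_action (transvection a b c)) x = x"
proof -
  define X where "X = (\<chi> i j. c * matrix_unit a b $ i $ j)"
  have X: "tensor_derivation X = (\<lambda>u. c *s tensor_derivation (matrix_unit a b) u)"
    by (auto simp: X_def tensor_derivation_def fun_eq_iff vec_eq_iff sum_distrib_left algebra_simps)
  have "ext_map (tensor_action (transvection a b (of_real s * c))) x = x" for s
  proof (rule ext_map_one_parameter_group[where N = "tensor_derivation X"])
    fix s t u
    show "tensor_action (transvection a b (of_real (s + t) * c)) u =
        tensor_action (transvection a b (of_real s * c)) (tensor_action (transvection a b (of_real t * c)) u)"
      using transvection_mult[OF assms(1)] by (simp add: tensor_action_mult[symmetric] algebra_simps)
    show "((\<lambda>s. tensor_action (transvection a b (of_real s * c)) u) has_vector_derivative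
        tensor_derivation X u) (at 0)"
    proof (rule has_vector_derivative_tensor_action)
      fix i j
      show "((\<lambda>s. transvection a b (of_real s * c) $ i $ j) has_vector_derivative X $ i $ j) (at 0)"
        using has_vector_derivative_transvection[of a b c i j] by (simp add: X_def)
    qed simp
    show "derivation (tensor_derivation X) x = 0"
      by (simp add: X derivation_scale_map x)
  qed (auto simp: linear_tensor_action linear_tensor_derivation tensor_action_one)
  from this[of 1] show ?thesis by simp
qed

text \<open>
  The stabiliser of \<open>x\<close> is closed under products and contains all transvections.
\<close>

lemma SL3_invariant_if_root_derivations_vanish:
  assumes "\<And>a b. a \<noteq> b \<Longrightarrow> root_derivation a b x = 0" and "det g = 1"
  shows "ext_map (tensor_action g) x = x"
  using \<open>det g = 1\<close>
proof (induction rule: SL3_transvection_induct)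
  case one
  have "tensor_action (mat 1) = (\<lambda>u. u)" by (simp add: fun_eq_iff tensor_action_one)
  then show ?case by (simp add: ext_map_ident)
next
  have comp: "ext_map (tensor_action (g ** h)) x = ext_map (tensor_action g) (ext_map (tensor_action h) x)" for g h
    by (simp add: ext_map_compose[OF linear_tensor_action] tensor_action_mult[abs_def])
  have fixed: "ext_map (tensor_action (transvection a b c)) x = x" if "a \<noteq> b" for a b c
    using ext_map_transvection assms(1) that by blast
  {
    case (left a b c A)
    have "A = transvection a b (- c) ** (transvection a b c ** A)"
      by (simp add: matrix_mul_assoc transvection_mult[OF left(1)])
    then show ?case using comp fixed left by metis
  next
    case (right a b c A)
    then show ?case using comp fixed by metis
  }
qed

text \<open>
  The orbit of \<open>x\<close> along a curve in \<open>SL(3)\<close> is constant, and its derivative at the identity is the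
  action of the tangent vector \<open>X\<close>.
\<close>

lemma derivation_zero_if_SL3_invariant:
  assumes x: "\<And>g. det g = 1 \<Longrightarrow> ext_map (tensor_action g) x = x"
    and g: "\<And>s. det (g s) = 1" "g 0 = mat 1"
    and g': "\<And>i j. ((\<lambda>s. g s $ i $ j) has_vector_derivative X $ i $ j) (at 0)"
  shows "derivation (tensor_derivation X) x = 0"
proof -
  have "((\<lambda>s. ext_map (tensor_action (g s)) x) has_vector_derivative derivation (tensor_derivation X) x) (at 0)"
    by (intro has_vector_derivative_ext_map linear_tensor_derivation
        has_vector_derivative_tensor_action g g') (simp add: g tensor_action_one)
  moreover have "((\<lambda>s::real. x) has_vector_derivative 0) (at 0)" by simp
  ultimately show ?thesis
    using vector_derivative_unique_at[where f = "\<lambda>s::real. x"] by (simp add: x g(1))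
qed

lemma root_derivation_zero_if_SL3_invariant:
  assumes x: "\<And>g. det g = 1 \<Longrightarrow> ext_map (tensor_action g) x = x" and "a \<noteq> b"
  shows "root_derivation a b x = 0"
  using has_vector_derivative_transvection[of a b 1]
  by (intro derivation_zero_if_SL3_invariant[OF x, of "\<lambda>s. transvection a b (of_real s)"])
    (simp_all add: det_transvection \<open>a \<noteq> b\<close>)

text \<open>
  The tangent vector \<open>E\<^sub>a\<^sub>a - E\<^sub>b\<^sub>b\<close> of the torus kills invariants, so \<open>E\<^sub>a\<^sub>a\<close> and \<open>E\<^sub>b\<^sub>b\<close> agree on them
  although neither is traceless.
\<close>

lemma diagonal_derivation_eq_if_SL3_invariant:
  assumes x: "\<And>g. det g = 1 \<Longrightarrow> ext_map (tensor_action g) x = x"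
  shows "root_derivation a a x = root_derivation b b x"
proof (cases "a = b")
  case False
  define g :: "real \<Rightarrow> complex ^ 3 ^ 3" where
    "g s = (\<chi> i j. if i = j then of_real (if i = a then exp s else if i = b then exp (- s) else 1) else 0)" for s
  have "derivation (tensor_derivation (matrix_unit a a - matrix_unit b b)) x = 0"
  proof (rule derivation_zero_if_SL3_invariant[OF x])
    fix s i j
    have "complex_of_real (exp s) * of_real (exp (- s)) = 1"
      by (metis exp_minus_inverse of_real_1 of_real_mult)
    then show "det (g s) = 1"
      using False exhaust_3[of a] exhaust_3[of b] by (auto simp: det_3 g_def mult.commute)
    show "((\<lambda>s. g s $ i $ j) has_vector_derivative (matrix_unit a a - matrix_unit b b) $ i $ j) (at 0)"
      using False by (cases "i = j"; cases "i = a"; cases "i = b")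
        (auto simp: g_def matrix_unit_def intro!: derivative_eq_intros)
    show "g 0 = mat 1"
      by (simp add: g_def mat_def vec_eq_iff)
  qed
  moreover have "tensor_derivation (matrix_unit a a - matrix_unit b b) =
      (\<lambda>t. tensor_derivation (matrix_unit a a) t - tensor_derivation (matrix_unit b b) t)"
    by (auto simp: fun_eq_iff tensor_derivation_def vec_eq_iff algebra_simps sum_subtractf sum.distrib)
  ultimately show ?thesis by (simp add: derivation_diff_map)
qed simp

section \<open>The symmetric power and its ten basis vectors\<close>

lemma tensor_zero [simp]: "tensor 0 y z = 0" "tensor x 0 z = 0" "tensor x y 0 = 0"
  by (auto simp: tensor_def vec_eq_iff)

lemma tensor_axis_nth:
  "tensor (axis i 1) (axis j 1) (axis k 1) $ (a, b, c) = (if i = a \<and> j = b \<and> k = c then 1 else 0)"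
  by (auto simp: tensor_def axis_def)

lemma matrix_unit_mult_axis: "matrix_unit a b *v axis i 1 = (if i = b then axis a 1 else 0)"
  by (auto simp: matrix_unit_def matrix_vector_mult_def vec_eq_iff axis_def if_distrib[of "\<lambda>x. _ * x"] cong: if_cong)

lemma sym_prod_expand:
  "sym_prod i j k = (1/6) *s (tensor (axis i 1) (axis j 1) (axis k 1) + tensor (axis i 1) (axis k 1) (axis j 1)
    + tensor (axis j 1) (axis i 1) (axis k 1) + tensor (axis j 1) (axis k 1) (axis i 1)
    + tensor (axis k 1) (axis i 1) (axis j 1) + tensor (axis k 1) (axis j 1) (axis i 1))"
proof -
  have f123: "finite {2::3, 3}" "1 \<notin> {2::3, 3}" by auto
  have f23: "finite {3::3}" "2 \<notin> {3::3}" by auto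
  show ?thesis
    unfolding sym_prod_def Let_def UNIV_3 sum_over_permutations_insert[OF f123]
      sum_over_permutations_insert[OF f23] permutes_sing
    by (simp add: fact_numeral permutes_sing Transposition.transpose_def)
qed

lemma sym_prod_commute:
  "sym_prod i j k = sym_prod j i k" "sym_prod i j k = sym_prod i k j"
  by (simp_all add: sym_prod_expand add_ac)

lemma sym_prod_nth:
  "sym_prod i j k $ (a, b, c) = (1/6) *
     ((if i = a \<and> j = b \<and> k = c then 1 else 0) + (if i = a \<and> k = b \<and> j = c then 1 else 0) +
      (if j = a \<and> i = b \<and> k = c then 1 else 0) + (if j = a \<and> k = b \<and> i = c then 1 else 0) +
      (if k = a \<and> i = b \<and> j = c then 1 else 0) + (if k = a \<and> j = b \<and> i = c then 1 else 0))"
  unfolding sym_prod_expand by (simp only: vector_smult_component vector_add_component tensor_axis_nth)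

text \<open>
  A symmetric tensor has the same coefficient at all rearrangements of \<open>(a, b, c)\<close>, so averaging over them
  returns that coefficient.
\<close>

lemma cinner_sym_prod:
  "cinner (sym_prod i j k) (sym_prod a b c) = sym_prod i j k $ (a, b, c)"
proof -
  have nth: "sym_prod i j k $ (b, a, c) = sym_prod i j k $ (a, b, c)"
    "sym_prod i j k $ (a, c, b) = sym_prod i j k $ (a, b, c)" for a b c
    by (simp_all add: sym_prod_expand tensor_axis_nth conj_ac add_ac)
  have "cinner t (tensor (axis a 1) (axis b 1) (axis c 1)) = t $ (a, b, c)" for t a b c
    by (simp only: axis_tensor[symmetric] cinner_axis)
  then have "cinner (sym_prod i j k) (sym_prod a b c) =
      (1/6) * (sym_prod i j k $ (a, b, c) + sym_prod i j k $ (a, c, b) + sym_prod i j k $ (b, a, c)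
      + sym_prod i j k $ (b, c, a) + sym_prod i j k $ (c, a, b) + sym_prod i j k $ (c, b, a))"
    by (subst (2) sym_prod_expand) (simp add: cinner_add_right cinner_scale_right)
  also have "\<dots> = sym_prod i j k $ (a, b, c)"
    using nth(1)[of a b c] nth(2)[of a b c] nth(1)[of c a b] nth(2)[of b a c] nth(1)[of b c a]
    by simp
  finally show ?thesis .
qed

lemma tensor_derivation_sym_prod:
  "tensor_derivation (matrix_unit a b) (sym_prod i j k) =
     (if i = b then sym_prod a j k else 0) + (if j = b then sym_prod i a k else 0) +
     (if k = b then sym_prod i j a else 0)"
proof -
  interpret Vector_Spaces.linear "(*s)" "(*s)" "tensor_derivation (matrix_unit a b)"
    by (rule linear_tensor_derivation)
  show ?thesis
    by (cases "i = b"; cases "j = b"; cases "k = b";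
        simp only: vec_eq_iff sym_prod_expand scale add tensor_derivation_tensor
          matrix_unit_mult_axis tensor_zero simp_thms if_True if_False; simp add: algebra_simps)
qed

text \<open>
  The basis vectors \<open>a\<^sub>1, \<dots>, a\<^sub>1\<^sub>0\<close> as sorted words in the letters \<open>1\<close>, \<open>2\<close>, \<open>3\<close>. Letters are natural numbers
  so that all computations below run by rewriting; they are mapped to the index type \<open>3\<close> by \<open>of_nat\<close>.
\<close>

definition letter_table :: "nat list list" where
  "letter_table =
    [[1,1,1], [2,2,2], [3,3,3], [1,1,2], [1,1,3], [2,2,3], [1,2,2], [1,3,3], [2,3,3], [1,2,3]]"

definition letters :: "nat \<Rightarrow> nat list" where
  "letters n = letter_table ! (n - 1)"

text \<open>
  The number of the basis vector obtained by trading one letter \<open>b\<close> for \<open>a\<close>. The value is only meaningful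
  if \<open>b\<close> occurs in the word.
\<close>

definition replace_letter :: "nat \<Rightarrow> nat \<Rightarrow> nat \<Rightarrow> nat" where
  "replace_letter a b n =
    Suc (length (takeWhile (\<lambda>w. w \<noteq> sort (a # remove1 b (letters n))) letter_table))"

lemma atLeastAtMost_1_10: "{1..10::nat} = {1, 2, 3, 4, 5, 6, 7, 8, 9, 10}"
  by (auto; presburger)

definition sym_word :: "nat list \<Rightarrow> tensor3" where
  "sym_word w = sym_prod (of_nat (w ! 0)) (of_nat (w ! 1)) (of_nat (w ! 2))"

lemma S3V_basis_eq_sym_word: "n \<in> {1..10} \<Longrightarrow> S3V_basis n = sym_word (letters n)"
  unfolding atLeastAtMost_1_10
  by (elim insertE emptyE) (simp_all add: S3V_basis_def sym_word_def letters_def letter_table_def)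

lemma length_3E:
  assumes "length w = 3"
  obtains i j k where "w = [i, j, k]"
  using assms by (auto simp: numeral_3_eq_3 length_Suc_conv)

lemma sym_word_sort: "sym_word (sort [i, j, k]) = sym_word [i, j, k]"
proof -
  have "sort [i, j, k] \<in> {[i, j, k], [i, k, j], [j, i, k], [j, k, i], [k, i, j], [k, j, i]}"
    by simp
  moreover have "sym_word [j, i, k] = sym_word [i, j, k]" "sym_word [i, k, j] = sym_word [i, j, k]" for i j k
    unfolding sym_word_def by (simp_all add: sym_prod_commute(1)[of "of_nat j"] sym_prod_commute(2)[of _ "of_nat k"])
  ultimately show ?thesis by auto
qed

lemma letters_props:
  "\<forall>n\<in>{1,2,3,4,5,6,7,8,9,10}. length (letters n) = 3 \<and> set (letters n) \<subseteq> {1,2,3} \<and>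
    (\<forall>a\<in>{1,2,3}. \<forall>b\<in>set (letters n). replace_letter a b n \<in> {1,2,3,4,5,6,7,8,9,10} \<and>
      letters (replace_letter a b n) = sort (a # remove1 b (letters n)))"
  by code_simp

text \<open>
  On polynomials \<open>E\<^sub>a\<^sub>b\<close> is \<open>e\<^sub>a \<partial>/\<partial>e\<^sub>b\<close>, so it maps a monomial to a multiple of a single monomial, the
  multiple being the exponent of \<open>e\<^sub>b\<close>. If that exponent is \<open>0\<close>, both sides vanish whatever
  \<open>replace_letter\<close> returns.
\<close>

lemma tensor_derivation_S3V_basis:
  assumes "a \<in> {1, 2, 3}" "b \<in> {1, 2, 3}" "n \<in> {1..10}"
  shows "tensor_derivation (matrix_unit (of_nat a) (of_nat b)) (S3V_basis n) =
    of_nat (count_list (letters n) b) *s S3V_basis (replace_letter a b n)"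
proof -
  obtain i j k where w: "letters n = [i, j, k]" and ijk: "{i, j, k} \<subseteq> {1, 2, 3}"
    using bspec[OF letters_props[folded atLeastAtMost_1_10] assms(3)]
    by (elim conjE length_3E) simp
  have of_nat_eq: "of_nat i = (of_nat b :: 3) \<longleftrightarrow> i = b" if "i \<in> {1, 2, 3}" for i
    using that assms(2) by auto
  let ?x = "S3V_basis (replace_letter a b n)"
  have target: "sym_word [p, q, r] = ?x"
    if "b \<in> set (letters n)" "mset [p, q, r] = mset (a # remove1 b (letters n))" for p q r
  proof -
    have "replace_letter a b n \<in> {1..10} \<and>
        letters (replace_letter a b n) = sort (a # remove1 b (letters n))"
      using bspec[OF letters_props[folded atLeastAtMost_1_10] assms(3)] assms(1) that(1) by blast
    then have "?x = sym_word (sort (a # remove1 b (letters n)))"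
      using S3V_basis_eq_sym_word[of "replace_letter a b n"] by metis
    also have "sort (a # remove1 b (letters n)) = sort [p, q, r]"
      using that(2) by (metis properties_for_sort mset_sort sorted_sort)
    finally show ?thesis by (simp only: sym_word_sort)
  qed
  have "tensor_derivation (matrix_unit (of_nat a) (of_nat b)) (S3V_basis n) =
      (if i = b then sym_word [a, j, k] else 0) + (if j = b then sym_word [i, a, k] else 0) +
      (if k = b then sym_word [i, j, a] else 0)"
    using S3V_basis_eq_sym_word[OF assms(3)] ijk
    by (simp add: tensor_derivation_sym_prod of_nat_eq w sym_word_def)
  also have "\<dots> = (if i = b then ?x else 0) + (if j = b then ?x else 0) + (if k = b then ?x else 0)"
    using target[of a j k] target[of i a k] target[of i j a] by (auto simp: w)
  also have "\<dots> = of_nat (count_list (letters n) b) *s ?x"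
    by (simp add: w vec_eq_iff)
  finally show ?thesis .
qed

lemma of_nat_3E:
  fixes a :: 3
  obtains n where "n \<in> {1, 2, 3}" "a = of_nat n"
proof -
  have "a = of_nat 1 \<or> a = of_nat 2 \<or> a = of_nat 3" using exhaust_3[of a] by simp
  then show ?thesis using that by blast
qed

lemma sym_prod_in_basis: "\<exists>n\<in>{1..10}. sym_prod i j k = S3V_basis n"
proof -
  obtain p where p: "p \<in> {1,2,3}" "i = of_nat p" by (rule of_nat_3E)
  obtain q where q: "q \<in> {1,2,3}" "j = of_nat q" by (rule of_nat_3E)
  obtain r where r: "r \<in> {1,2,3}" "k = of_nat r" by (rule of_nat_3E)
  have "\<forall>p\<in>{1,2,3}. \<forall>q\<in>{1,2,3}. \<forall>r\<in>{1,2,3}. \<exists>n\<in>{1,2,3,4,5,6,7,8,9,10}. letters n = sort [p, q, r]"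
    by code_simp
  with p q r obtain n where n: "n \<in> {1..10}" "letters n = sort [p, q, r]"
    unfolding atLeastAtMost_1_10 by blast
  then have "S3V_basis n = sym_word [p, q, r]"
    using S3V_basis_eq_sym_word[OF n(1)] by (simp only: sym_word_sort)
  then have "sym_prod i j k = S3V_basis n" using p(2) q(2) r(2) by (simp add: sym_word_def)
  then show ?thesis using n(1) by blast
qed

lemma S3V_subset_span: "S3V \<subseteq> vec.span (S3V_basis ` {1..10})"
proof -
  have "symmetrize t \<in> vec.span (S3V_basis ` {1..10})" for t
    unfolding symmetrize_def
  proof (intro vec.span_sum)
    fix p :: "3 \<times> 3 \<times> 3"
    obtain i j k where p: "p = (i, j, k)" by (cases p)
    obtain n where "n \<in> {1..10}" "sym_prod i j k = S3V_basis n" using sym_prod_in_basis by blast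
    then have "sym_prod i j k \<in> vec.span (S3V_basis ` {1..10})" by (simp add: vec.span_base)
    then show "(case p of (i, j, k) \<Rightarrow> t $ (i, j, k) *s sym_prod i j k) \<in> vec.span (S3V_basis ` {1..10})"
      by (simp add: p vec.span_scale)
  qed
  then show ?thesis by (auto simp: S3V_def)
qed

lemma S3V_basis_in_S3V:
  assumes "n \<in> {1..10}"
  shows "S3V_basis n \<in> S3V"
proof -
  have "sym_prod i j k = symmetrize (axis (i, j, k) 1)" for i j k
  proof -
    have "symmetrize (axis (i, j, k) 1) = (\<Sum>p\<in>UNIV. if p = (i, j, k) then sym_prod i j k else 0)"
      unfolding symmetrize_def by (intro sum.cong) (auto simp: axis_def split: if_splits)
    then show ?thesis by simp
  qed
  then show ?thesis
    using S3V_basis_eq_sym_word[OF assms] by (simp add: sym_word_def S3V_def)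
qed

section \<open>Computing with combinations of wedge monomials\<close>

text \<open>
  The sign of the permutation that sorts the list, as the product of the signs of all differences of entries;
  it is \<open>0\<close> if an entry is repeated.
\<close>

fun sort_sign :: "nat list \<Rightarrow> int" where
  "sort_sign [] = 1"
| "sort_sign (a # l) = (\<Prod>b\<leftarrow>l. if a < b then 1 else if b < a then - 1 else 0) * sort_sign l"

lemma monomial_Nil [simp]: "monomial [] = ext_one"
  by (simp add: monomial_def)

lemma monomial_Cons: "monomial (n # l) = ext_vec (S3V_basis n) \<and>\<^sub>E monomial l"
  by (simp add: monomial_def)

lemma monomial_append: "monomial (l @ l') = monomial l \<and>\<^sub>E monomial l'"
  by (simp add: monomial_def wedge_list_append)

lemma monomial_insort:
  "sorted l \<Longrightarrow> monomial (a # l) =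
     of_int (\<Prod>b\<leftarrow>l. if a < b then 1 else if b < a then - 1 else 0) *s monomial (insort a l)"
proof (induction l)
  case (Cons b l)
  have "monomial (b # b # l) = 0"
    by (simp add: monomial_Cons ext_vec_square flip: wedge_assoc)
  moreover have "monomial (a # b # l) = - (ext_vec (S3V_basis b) \<and>\<^sub>E monomial (a # l))"
    using ext_vec_anticommute' by (simp add: monomial_Cons)
  moreover have "(\<Prod>b\<leftarrow>l. if a < b then 1 else if b < a then - 1 else 0) = (1 :: int)" if "a < b"
  proof -
    have "\<forall>b\<in>set l. a < b" using Cons.prems that by fastforce
    then show ?thesis by (induction l) auto
  qed
  ultimately show ?case
    using Cons by (cases a b rule: linorder_cases)
      (auto simp: wedge_scale_right monomial_Cons vec.scale_minus_left)
qed simp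

lemma monomial_sort: "monomial l = of_int (sort_sign l) *s monomial (sort l)"
proof (induction l)
  case (Cons a l)
  have sign: "(\<Prod>b\<leftarrow>sort l. f b) = (\<Prod>b\<leftarrow>l. f b)" for f :: "nat \<Rightarrow> int"
    by (metis mset_map mset_sort prod_mset_prod_list)
  have "monomial (a # l) = of_int (sort_sign l) *s monomial (a # sort l)"
    by (subst monomial_Cons, subst Cons.IH) (simp add: monomial_Cons wedge_scale_right)
  then show ?case by (simp add: monomial_insort[of "sort l" a] sign mult.commute)
qed simp

lemma monomial_eq_0_if_not_distinct:
  assumes "\<not> distinct l"
  shows "monomial l = 0"
proof -
  have *: "monomial (a # l) = 0" if "a \<in> set l" for a l
    using that
  proof (induction l)
    case (Cons b l)
    have "monomial (a # b # l) = - (ext_vec (S3V_basis b) \<and>\<^sub>E monomial (a # l))"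
      using ext_vec_anticommute' by (simp add: monomial_Cons)
    moreover have "monomial (b # b # l) = 0"
      by (simp add: monomial_Cons ext_vec_square flip: wedge_assoc)
    ultimately show ?case using Cons by (cases "a = b") auto
  qed simp
  show ?thesis
    using assms
  proof (induction l)
    case (Cons a l)
    then show ?case using *[of a l] by (cases "distinct l") (auto simp: monomial_Cons)
  qed simp
qed

lemma sort_sign_nonzero: "distinct l \<Longrightarrow> sort_sign l \<noteq> 0"
  by (induction l) (auto simp: prod_list_zero_iff)

text \<open>
  Coefficients are integers to keep evaluation cheap; the invariant of degree seven is therefore handled
  after multiplication by \<open>9\<close>.
\<close>

definition lincomb :: "(int \<times> nat list) list \<Rightarrow> (3 \<times> 3 \<times> 3) ext" where
  "lincomb cs = (\<Sum>(c, l)\<leftarrow>cs. of_int c *s monomial l)"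

lemma lincomb_simps [simp]:
  "lincomb [] = 0" "lincomb ((c, l) # cs) = of_int c *s monomial l + lincomb cs"
  by (simp_all add: lincomb_def)

lemma lincomb_append: "lincomb (cs @ ds) = lincomb cs + lincomb ds"
  by (simp add: lincomb_def)

lemma lincomb_map_Cons: "lincomb (map (\<lambda>(c, l). (c, n # l)) cs) = ext_vec (S3V_basis n) \<and>\<^sub>E lincomb cs"
  by (induction cs) (auto simp: monomial_Cons wedge_add_right wedge_scale_right)

lemma lincomb_eq_0: "\<forall>(c, l)\<in>set cs. c = 0 \<Longrightarrow> lincomb cs = 0"
  by (induction cs) auto

fun add_term :: "int \<Rightarrow> nat list \<Rightarrow> (int \<times> nat list) list \<Rightarrow> (int \<times> nat list) list" where
  "add_term c l [] = [(c, l)]"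
| "add_term c l ((d, m) # cs) = (if l = m then (c + d, m) # cs else (d, m) # add_term c l cs)"

text \<open>
  The normal form of a combination: all lists sorted with their sign, and equal lists merged. Terms with
  coefficient \<open>0\<close> may remain.
\<close>

fun collect :: "(int \<times> nat list) list \<Rightarrow> (int \<times> nat list) list" where
  "collect [] = []"
| "collect ((c, l) # cs) = add_term (c * sort_sign l) (sort l) (collect cs)"

lemma lincomb_collect: "lincomb (collect cs) = lincomb cs"
proof (induction cs rule: collect.induct)
  case (2 c l cs)
  have "lincomb (add_term c l cs) = of_int c *s monomial l + lincomb cs" for c l cs
    by (induction c l cs rule: add_term.induct) (auto simp: vec.scale_left_distrib)
  then show ?case using 2 monomial_sort[of l] by simp
qed simp

text \<open>
  The Leibniz rule for \<open>E\<^sub>a\<^sub>b\<close> applied to a wedge monomial.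
\<close>

fun raise_terms :: "nat \<Rightarrow> nat \<Rightarrow> nat list \<Rightarrow> (int \<times> nat list) list" where
  "raise_terms a b [] = []"
| "raise_terms a b (n # l) =
     (if b \<in> set (letters n) then [(int (count_list (letters n) b), replace_letter a b n # l)] else []) @
     map (\<lambda>(c, l'). (c, n # l')) (raise_terms a b l)"

lemma root_derivation_monomial:
  assumes "a \<in> {1, 2, 3}" "b \<in> {1, 2, 3}" "set l \<subseteq> {1..10}"
  shows "root_derivation (of_nat a) (of_nat b) (monomial l) = lincomb (raise_terms a b l)"
  using assms(3)
proof (induction l)
  case (Cons n l)
  then have "n \<in> {1..10}" "set l \<subseteq> {1..10}" by auto
  with Cons.IH have "root_derivation (of_nat a) (of_nat b) (monomial (n # l)) =
      of_nat (count_list (letters n) b) *s monomial (replace_letter a b n # l) +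
      lincomb (map (\<lambda>(c, l'). (c, n # l')) (raise_terms a b l))"
    by (simp only: monomial_Cons root_derivation_wedge tensor_derivation_S3V_basis[OF assms(1,2)]
        lincomb_map_Cons ext_vec_scale wedge_scale_left)
  then show ?case
    by (simp add: lincomb_append count_list_0_iff)
qed simp

definition raise_lincomb :: "nat \<Rightarrow> nat \<Rightarrow> (int \<times> nat list) list \<Rightarrow> (int \<times> nat list) list" where
  "raise_lincomb a b cs = concat (map (\<lambda>(c, l). map (\<lambda>(d, l'). (c * d, l')) (raise_terms a b l)) cs)"

lemma root_derivation_lincomb:
  assumes "a \<in> {1, 2, 3}" "b \<in> {1, 2, 3}" "\<forall>(c, l)\<in>set cs. set l \<subseteq> {1..10}"
  shows "root_derivation (of_nat a) (of_nat b) (lincomb cs) = lincomb (raise_lincomb a b cs)"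
proof -
  have scale: "lincomb (map (\<lambda>(d, l). (c * d, l)) ds) = of_int c *s lincomb ds" for c ds
    by (induction ds) (auto simp: vec.scale_right_distrib)
  show ?thesis
    using assms(3)
  proof (induction cs)
    case (Cons p cs)
    then show ?case
      by (cases p) (simp add: raise_lincomb_def derivation_add derivation_scale scale lincomb_append
          root_derivation_monomial[OF assms(1,2)])
  qed (simp add: raise_lincomb_def)
qed

text \<open>
  The eigenvalue of the wedge monomial \<open>a\<^sub>l\<close> under \<open>E\<^sub>a\<^sub>a\<close>.
\<close>

definition weight :: "nat \<Rightarrow> nat list \<Rightarrow> nat" where
  "weight a l = (\<Sum>n\<leftarrow>l. count_list (letters n) a)"

lemma replace_letter_same:
  "\<forall>n\<in>{1,2,3,4,5,6,7,8,9,10}. \<forall>a\<in>set (letters n). replace_letter a a n = n"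
  by code_simp

lemma root_derivation_monomial_weight:
  assumes "a \<in> {1, 2, 3}" "set l \<subseteq> {1..10}"
  shows "root_derivation (of_nat a) (of_nat a) (monomial l) = of_nat (weight a l) *s monomial l"
  using assms(2)
proof (induction l)
  case (Cons n l)
  then have n: "n \<in> {1..10}" and l: "set l \<subseteq> {1..10}" by auto
  have "tensor_derivation (matrix_unit (of_nat a) (of_nat a)) (S3V_basis n) =
      of_nat (count_list (letters n) a) *s S3V_basis n"
  proof (cases "a \<in> set (letters n)")
    case True
    then show ?thesis
      using tensor_derivation_S3V_basis[OF assms(1,1) n]
        bspec[OF bspec[OF replace_letter_same[folded atLeastAtMost_1_10] n] True] by simp
  next
    case False
    then show ?thesis
      using tensor_derivation_S3V_basis[OF assms(1,1) n] by (simp add: count_list_0_iff[THEN iffD2])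
  qed
  then show ?case
    using Cons.IH[OF l]
    by (simp add: monomial_Cons root_derivation_wedge ext_vec_scale wedge_scale_left wedge_scale_right
        weight_def vec.scale_left_distrib)
qed (simp add: weight_def)

section \<open>An orthogonal basis of the exterior algebra\<close>

definition basis_lists :: "nat list set" where
  "basis_lists = {l. sorted_wrt (<) l \<and> set l \<subseteq> {1..10}}"

lemma basis_listsD: "l \<in> basis_lists \<Longrightarrow> sorted l \<and> distinct l \<and> set l \<subseteq> {1..10}"
  by (auto simp: basis_lists_def strict_sorted_iff)

abbreviation vol_list :: "nat list" where
  "vol_list \<equiv> [1, 2, 3, 4, 5, 6, 7, 8, 9, 10]"

lemma vol_list_basis: "vol_list \<in> basis_lists"
  by (simp add: basis_lists_def)

lemma monomial_Cons_in_span: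
  assumes "n \<in> {1..10}" "l \<in> basis_lists"
  shows "monomial (n # l) \<in> vec.span {monomial l' |l'. l' \<in> basis_lists \<and> length l' = Suc (length l)}"
proof (cases "n \<in> set l")
  case True
  then show ?thesis by (simp add: monomial_eq_0_if_not_distinct vec.span_zero)
next
  case False
  have "sorted l" "distinct l" using assms(2) by (auto simp: basis_lists_def strict_sorted_iff)
  then have "insort n l \<in> basis_lists" "length (insort n l) = Suc (length l)"
    using False assms by (auto simp: basis_lists_def strict_sorted_iff sorted_insort distinct_insort set_insort_key)
  then have "monomial (insort n l) \<in> vec.span {monomial l' |l'. l' \<in> basis_lists \<and> length l' = Suc (length l)}"
    by (intro vec.span_base) blast
  then show ?thesis
    unfolding monomial_insort[OF \<open>sorted l\<close>, of n] by (rule vec.span_scale)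
qed

text \<open>
  Expanding each factor in \<open>a\<^sub>1, \<dots>, a\<^sub>1\<^sub>0\<close> and sorting leaves increasing monomials. The length is tracked
  because the statement is needed for each homogeneous component.
\<close>

lemma wedge_list_in_span:
  assumes "set us \<subseteq> S3V"
  shows "wedge_list us \<in> vec.span {monomial l |l. l \<in> basis_lists \<and> length l = length us}"
  using assms
proof (induction us)
  case Nil
  have "[] \<in> basis_lists" by (simp add: basis_lists_def)
  then show ?case by (auto intro!: vec.span_base exI[of _ "[]"])
next
  case (Cons u us)
  let ?M = "\<lambda>k. {monomial l |l. l \<in> basis_lists \<and> length l = k}"
  have *: "ext_vec (S3V_basis n) \<and>\<^sub>E y \<in> vec.span (?M (Suc k))" if "n \<in> {1..10}" "y \<in> vec.span (?M k)" for n y k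
    using that(2)
  proof (induction rule: vec.span_induct_alt)
    case base
    show ?case by (simp add: vec.span_zero)
  next
    case (step c x y)
    then obtain l where l: "x = monomial l" "l \<in> basis_lists" "length l = k" by blast
    then have "ext_vec (S3V_basis n) \<and>\<^sub>E x \<in> vec.span (?M (Suc k))"
      using monomial_Cons_in_span[OF that(1) l(2)] by (simp add: monomial_Cons)
    then show ?case
      using step by (simp add: wedge_add_right wedge_scale_right vec.span_add vec.span_scale)
  qed
  have "u \<in> vec.span (S3V_basis ` {1..10})" using Cons.prems S3V_subset_span by auto
  then have "ext_vec u \<and>\<^sub>E wedge_list us \<in> vec.span (?M (Suc (length us)))"
  proof (induction rule: vec.span_induct_alt)
    case base
    have "ext_vec 0 = (0 :: (3 \<times> 3 \<times> 3) ext)" using ext_vec_scale[of 0 0] by simp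
    then show ?case by (simp add: vec.span_zero)
  next
    case (step c x y)
    then show ?case
      using * Cons by (auto simp: ext_vec_add ext_vec_scale wedge_add_left wedge_scale_left intro!: vec.span_add vec.span_scale)
  qed
  then show ?case by simp
qed

lemma ext_power_subset_span: "ext_power k S3V \<subseteq> vec.span {monomial l |l. l \<in> basis_lists \<and> length l = k}"
  unfolding ext_power_def
  by (intro vec.span_minimal vec.subspace_span) (use wedge_list_in_span in auto)

lemma ext_algebra_subset_span: "ext_algebra S3V \<subseteq> vec.span (monomial ` basis_lists)"
  unfolding ext_algebra_def
proof (intro vec.span_minimal vec.subspace_span subsetI)
  fix x assume "x \<in> {wedge_list us |us. set us \<subseteq> S3V}"
  then obtain us where us: "x = wedge_list us" "set us \<subseteq> S3V" by blast
  have "{monomial l |l. l \<in> basis_lists \<and> length l = length us} \<subseteq> monomial ` basis_lists"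
    by auto
  from vec.span_mono[OF this] show "x \<in> vec.span (monomial ` basis_lists)"
    using wedge_list_in_span[OF us(2)] us(1) by auto
qed

lemma monomial_in_ext_power:
  assumes "set l \<subseteq> {1..10}"
  shows "monomial l \<in> ext_power (length l) S3V"
  unfolding ext_power_def monomial_def
  by (intro vec.span_base CollectI exI[of _ "map S3V_basis l"]) (use assms S3V_basis_in_S3V in auto)

lemma ext_power_subset_ext_algebra: "ext_power k W \<subseteq> ext_algebra W"
  unfolding ext_power_def ext_algebra_def by (intro vec.span_mono) auto

text \<open>
  The squared norm of \<open>a\<^sub>n\<close>, the reciprocal of the number of distinct rearrangements of its letters.
\<close>

definition basis_norm :: "nat \<Rightarrow> complex" where
  "basis_norm n = (if n \<le> 3 then 1 else if n \<le> 9 then 1/3 else 1/6)"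

lemma basis_norm_nonzero: "(\<Prod>n\<leftarrow>l. basis_norm n) \<noteq> 0"
  by (auto simp: prod_list_zero_iff basis_norm_def)

lemma cinner_S3V_basis:
  assumes "m \<in> {1..10}" "n \<in> {1..10}"
  shows "cinner (S3V_basis m) (S3V_basis n) = (if m = n then basis_norm n else 0)"
proof -
  have "\<forall>n\<in>{1,2,3,4,5,6,7,8,9,10}. cinner (S3V_basis m) (S3V_basis n) = (if m = n then basis_norm n else 0)"
    if "m \<in> {1,2,3,4,5,6,7,8,9,10}" for m
    using that
    by (elim insertE emptyE)
      (simp_all add: S3V_basis_def cinner_sym_prod sym_prod_nth basis_norm_def)
  then show ?thesis using assms by (metis atLeastAtMost_1_10)
qed

lemma contract_monomial_not_in:
  assumes "n \<in> {1..10}" "set l \<subseteq> {1..10}" "n \<notin> set l"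
  shows "contract (S3V_basis n) (monomial l) = 0"
  using assms(2,3)
proof (induction l)
  case (Cons m l)
  then have "cinner (S3V_basis m) (S3V_basis n) = 0" "contract (S3V_basis n) (monomial l) = 0"
    using cinner_S3V_basis assms(1) by auto
  then show ?case by (simp add: monomial_Cons contract_ext_vec_wedge)
qed simp

text \<open>
  Contracting with the smaller of the two leading vectors gives \<open>0\<close> by orthogonality unless the leading
  vectors agree, in which case both can be removed.
\<close>

lemma ext_inner_monomial:
  assumes "I \<in> basis_lists" "J \<in> basis_lists"
  shows "ext_inner (monomial I) (monomial J) = (if I = J then \<Prod>n\<leftarrow>I. basis_norm n else 0)"
  using assms
proof (induction I arbitrary: J)
  case Nil
  show ?case
  proof (cases J)
    case Nil
    have "ext_inner ext_one (ext_one :: (3 \<times> 3 \<times> 3) ext) = (\<Sum>S\<in>UNIV. if S = ({} :: (3 \<times> 3 \<times> 3) set) then 1 else 0)"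
      unfolding ext_inner_def by (intro sum.cong) (auto simp: ext_one_def axis_def)
    then show ?thesis using Nil by simp
  next
    case (Cons n J)
    have "ext_inner (monomial (n # J)) (monomial []) = 0"
      by (simp add: monomial_Cons ext_inner_wedge_left)
    then show ?thesis using Cons ext_inner_cnj[of "monomial (n # J)" "monomial []"] by simp
  qed
next
  case (Cons m I)
  have m: "m \<in> {1..10}" "m \<notin> set I" "I \<in> basis_lists" "\<And>n. n \<in> set I \<Longrightarrow> m < n"
    using Cons.prems(1) by (auto simp: basis_lists_def)
  have J10: "set J \<subseteq> {1..10}" using Cons.prems(2) by (simp add: basis_lists_def)
  consider "J = []" | n J' where "J = n # J'" "m < n" | J' where "J = m # J'" | n J' where "J = n # J'" "n < m"
    by (metis list.exhaust linorder_neqE_nat)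
  then show ?case
  proof cases
    case 1
    then show ?thesis by (simp add: monomial_Cons ext_inner_wedge_left)
  next
    case (2 n J')
    then have "m \<notin> set J" using Cons.prems(2) by (auto simp: basis_lists_def)
    then show ?thesis
      using contract_monomial_not_in[OF m(1) J10] by (auto simp: monomial_Cons[of m] ext_inner_wedge_left)
  next
    case (3 J')
    then have J': "J' \<in> basis_lists" "m \<notin> set J'" "set J' \<subseteq> {1..10}"
      using Cons.prems(2) by (auto simp: basis_lists_def)
    have "contract (S3V_basis m) (monomial J) = basis_norm m *s monomial J'"
      using contract_monomial_not_in[OF m(1) J'(3,2)] cinner_S3V_basis[OF m(1) m(1)]
      by (simp add: 3 monomial_Cons contract_ext_vec_wedge)
    moreover have "cnj (basis_norm m) = basis_norm m" by (simp add: basis_norm_def)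
    ultimately show ?thesis
      using Cons.IH[OF m(3) J'(1)] 3
      by (simp add: monomial_Cons[of m I] ext_inner_wedge_left ext_inner_scale_right)
  next
    case (4 n J')
    then have n: "n \<in> {1..10}" "n \<notin> set (m # I)" "set (m # I) \<subseteq> {1..10}"
      using Cons.prems m(4)[of n] by (auto simp: basis_lists_def)
    have "ext_inner (monomial J) (monomial (m # I)) = 0"
      using contract_monomial_not_in[OF n(1,3,2)] by (simp add: 4 monomial_Cons[of n] ext_inner_wedge_left)
    then show ?thesis
      using 4 ext_inner_cnj[of "monomial J" "monomial (m # I)"] by auto
  qed
qed

lemma ext_inner_monomial_lincomb:
  assumes "I \<in> basis_lists" "\<forall>(c, l)\<in>set cs. l \<in> basis_lists"
  shows "ext_inner (monomial I) (lincomb cs) =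
    (\<Sum>(c, l)\<leftarrow>cs. if l = I then of_int c else 0) * (\<Prod>n\<leftarrow>I. basis_norm n)"
  using assms(2)
  by (induction cs) (auto simp: ext_inner_add_right ext_inner_scale_right ext_inner_monomial[OF assms(1)]
      algebra_simps)

lemma monomial_vol_list_nonzero: "monomial vol_list \<noteq> 0"
proof
  assume "monomial vol_list = 0"
  then have "ext_inner (monomial vol_list) (monomial vol_list) = 0" by simp
  then have "(\<Prod>n\<leftarrow>vol_list. basis_norm n) = 0"
    by (simp only: ext_inner_monomial[OF vol_list_basis vol_list_basis] if_True refl)
  then show False using basis_norm_nonzero by blast
qed

text \<open>
  Orthogonality extends to the span, which contains \<open>x\<close> itself.
\<close>

lemma eq_0_if_orthogonal_to_basis:
  assumes "x \<in> vec.span (monomial ` A)" "\<And>l. l \<in> A \<Longrightarrow> ext_inner (monomial l) x = 0"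
  shows "x = 0"
proof -
  have "ext_inner z x = 0" if "z \<in> vec.span (monomial ` A)" for z
    using that
    by (induction rule: vec.span_induct_alt) (auto simp: ext_inner_add_left ext_inner_scale_left assms(2))
  then show ?thesis using assms(1) ext_inner_self_eq_0 by blast
qed

section \<open>The invariants of degree three and seven\<close>

text \<open>
  This list and the next one stand for \<open>v\<close> and for \<open>9 *v\<close>.
\<close>

definition invariant3 :: "(int \<times> nat list) list" where
  "invariant3 = [(1, [1,2,3]), (-3, [3,4,7]), (-3, [1,6,9]), (3, [2,5,8]), (6, [7,8,10]),
     (-6, [4,9,10]), (6, [5,6,10]), (3, [5,7,9]), (3, [4,6,8])]"

definition invariant7 :: "(int \<times> nat list) list" where
  "invariant7 = [(9, [4,5,6,7,8,9,10]), (-3, [1,2,5,6,8,9,10]), (-3, [2,3,4,5,7,8,10]),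
     (-3, [1,3,4,6,7,9,10]), (-1, [1,2,3,4,5,6,9]), (1, [1,2,3,5,6,7,8]), (-1, [1,2,3,4,7,8,9]),
     (-1, [1,2,3,4,6,8,10]), (1, [1,2,3,5,7,9,10])]"

lemma invariant3_basis: "\<forall>(c, l)\<in>set invariant3. l \<in> basis_lists"
  by (simp add: invariant3_def basis_lists_def)

lemma invariant7_basis: "\<forall>(c, l)\<in>set invariant7. l \<in> basis_lists"
  by (simp add: invariant7_def basis_lists_def)

text \<open>
  These evaluations are the whole content of the invariance of \<open>v\<close> and \<open>*v\<close>: after collecting, all terms of
  their images under the six root vectors cancel.
\<close>

lemma raise_invariant3:
  "\<forall>a\<in>{1,2,3}. \<forall>b\<in>{1,2,3}. a \<noteq> b \<longrightarrow> (\<forall>(c, l)\<in>set (collect (raise_lincomb a b invariant3)). c = 0)"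
  by code_simp

lemma raise_invariant7:
  "\<forall>a\<in>{1,2,3}. \<forall>b\<in>{1,2,3}. a \<noteq> b \<longrightarrow> (\<forall>(c, l)\<in>set (collect (raise_lincomb a b invariant7)). c = 0)"
  by code_simp

lemma lincomb_SL3_invariant:
  assumes cs: "\<forall>(c, l)\<in>set cs. set l \<subseteq> {1..10}"
    and raise0: "\<forall>a\<in>{1,2,3}. \<forall>b\<in>{1,2,3}. a \<noteq> b \<longrightarrow> (\<forall>(c, l)\<in>set (collect (raise_lincomb a b cs)). c = 0)"
    and "det g = 1"
  shows "ext_map (tensor_action g) (lincomb cs) = lincomb cs"
proof (rule SL3_invariant_if_root_derivations_vanish)
  fix a b :: 3 assume "a \<noteq> b"
  obtain m n where mn: "m \<in> {1,2,3}" "a = of_nat m" "n \<in> {1,2,3}" "b = of_nat n"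
    using of_nat_3E by metis
  then have "m \<noteq> n" using \<open>a \<noteq> b\<close> by auto
  then have "lincomb (collect (raise_lincomb m n cs)) = 0"
    using raise0 mn by (intro lincomb_eq_0) blast
  then show "root_derivation a b (lincomb cs) = 0"
    using root_derivation_lincomb[OF mn(1,3) cs] mn by (simp add: lincomb_collect)
qed fact

lemma sl3_invariants_closed:
  shows "ext_one \<in> sl3_invariants"
    and "x \<in> sl3_invariants \<Longrightarrow> y \<in> sl3_invariants \<Longrightarrow> x + y \<in> sl3_invariants"
    and "x \<in> sl3_invariants \<Longrightarrow> c *s x \<in> sl3_invariants"
    and "x \<in> sl3_invariants \<Longrightarrow> y \<in> sl3_invariants \<Longrightarrow> x \<and>\<^sub>E y \<in> sl3_invariants"
proof -
  have "ext_one \<in> ext_algebra S3V"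
    unfolding ext_algebra_def by (intro vec.span_base CollectI exI[of _ "[]"]) simp
  then show "ext_one \<in> sl3_invariants" by (simp add: sl3_invariants_def)
  show "x \<in> sl3_invariants \<Longrightarrow> y \<in> sl3_invariants \<Longrightarrow> x + y \<in> sl3_invariants"
    "x \<in> sl3_invariants \<Longrightarrow> c *s x \<in> sl3_invariants" for x y c
    by (auto simp: sl3_invariants_def ext_algebra_def ext_map_add ext_map_scale
        intro: vec.span_add vec.span_scale)
  show "x \<and>\<^sub>E y \<in> sl3_invariants" if x: "x \<in> sl3_invariants" and y: "y \<in> sl3_invariants"
  proof -
    have "wedge_list us \<and>\<^sub>E y \<in> ext_algebra S3V" if "y \<in> ext_algebra S3V" "set us \<subseteq> S3V" for us y
      using that(1) unfolding ext_algebra_def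
    proof (induction rule: vec.span_induct_alt)
      case (step c z y)
      then obtain ws where "z = wedge_list ws" "set ws \<subseteq> S3V" by blast
      then have "wedge_list us \<and>\<^sub>E z \<in> {wedge_list us |us. set us \<subseteq> S3V}"
        using that(2) by (auto simp: wedge_list_append[symmetric] intro!: exI[of _ "us @ ws"])
      then show ?case
        using step by (simp add: wedge_add_right wedge_scale_right vec.span_add vec.span_scale vec.span_base)
    qed (simp add: vec.span_zero)
    then have *: "wedge_list us \<and>\<^sub>E y \<in> ext_algebra S3V" if "set us \<subseteq> S3V" for us
      using that y by (simp add: sl3_invariants_def)
    have "x \<in> ext_algebra S3V" using x by (simp add: sl3_invariants_def)
    then have "x \<and>\<^sub>E y \<in> ext_algebra S3V"
      unfolding ext_algebra_def
    proof (induction rule: vec.span_induct_alt)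
      case (step c z x)
      then have "z \<and>\<^sub>E y \<in> vec.span {wedge_list us |us. set us \<subseteq> S3V}"
        using * by (auto simp: ext_algebra_def)
      then show ?case
        using step by (simp add: wedge_add_left wedge_scale_left vec.span_add vec.span_scale)
    qed (simp add: vec.span_zero)
    then show ?thesis
      using x y by (simp add: sl3_invariants_def ext_map_wedge[OF linear_tensor_action])
  qed
qed

lemma lincomb_in_sl3_invariants:
  assumes cs: "\<forall>(c, l)\<in>set cs. set l \<subseteq> {1..10}"
    and raise0: "\<forall>a\<in>{1,2,3}. \<forall>b\<in>{1,2,3}. a \<noteq> b \<longrightarrow> (\<forall>(c, l)\<in>set (collect (raise_lincomb a b cs)). c = 0)"
  shows "lincomb cs \<in> sl3_invariants"
proof -
  have "lincomb cs \<in> ext_algebra S3V"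
    using cs
  proof (induction cs)
    case (Cons p cs)
    obtain c l where p: "p = (c, l)" by (cases p)
    have "monomial l \<in> ext_algebra S3V"
      using Cons.prems monomial_in_ext_power ext_power_subset_ext_algebra by (auto simp: p)
    then show ?case
      using Cons by (auto simp: p ext_algebra_def intro!: vec.span_add vec.span_scale)
  qed (simp add: ext_algebra_def vec.span_zero)
  then show ?thesis
    using lincomb_SL3_invariant[OF assms] by (simp add: sl3_invariants_def)
qed

section \<open>An invariant is determined by four inner products\<close>

text \<open>
  One monomial for each of the invariants \<open>1\<close>, \<open>v\<close>, \<open>*v\<close> and \<open>vol\<close>, occurring in that invariant and in no
  other of the four.
\<close>

abbreviation generator_lists :: "nat list list" where
  "generator_lists \<equiv> [[], [1,2,3], [4,5,6,7,8,9,10], vol_list]"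

text \<open>
  An entry \<open>(a, b, T, S)\<close> asserts that the expansion of \<open>E\<^sub>a\<^sub>b a\<^sub>T\<close> contains, besides monomials known
  to be orthogonal to the invariant, exactly the monomial \<open>a\<^sub>S\<close>. The list \<open>K\<close> of known monomials grows by
  \<open>S\<close> from entry to entry.
\<close>

fun elimination :: "nat list list \<Rightarrow> (nat \<times> nat \<times> nat list \<times> nat list) list \<Rightarrow> bool" where
  "elimination K [] \<longleftrightarrow> True"
| "elimination K ((a, b, T, S) # st) \<longleftrightarrow>
     a \<in> {1,2,3} \<and> b \<in> {1,2,3} \<and> a \<noteq> b \<and> (\<forall>n\<in>set T. 1 \<le> n \<and> n \<le> 10) \<and>
     map snd (filter (\<lambda>(c, l). c \<noteq> 0 \<and> l \<notin> set K) (collect (raise_terms a b T))) = [S] \<and>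
     elimination (S # K) st"

text \<open>
  The last components run over the 60 monomials of weight zero other than those of \<open>generator_lists\<close>, ordered
  by degree. The entries come from a search for a triangular system: in each degree, entries whose expansion
  has a single unknown monomial are added as long as there are any.
\<close>

definition elimination_table :: "(nat \<times> nat \<times> nat list \<times> nat list) list" where
  "elimination_table =
    [(3, 1, [4], [10]), (3, 1, [1,6], [5,6]), (2, 1, [1,9], [4,9]), (1, 2, [2,8], [7,8]),
     (3, 1, [1,2,8], [2,5,8]), (3, 2, [1,2,9], [1,6,9]), (2, 1, [1,3,7], [3,4,7]),
     (2, 1, [1,6,8], [4,6,8]), (3, 1, [1,6,10], [5,6,10]), (3, 1, [1,7,9], [5,7,9]),
     (2, 1, [1,9,10], [4,9,10]), (1, 2, [2,8,10], [7,8,10]), (3, 1, [1,2,5,9], [1,2,8,9]),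
     (2, 1, [1,3,4,6], [1,3,6,7]), (1, 3, [2,3,4,8], [2,3,4,5]), (3, 1, [1,2,3,4], [1,2,3,10]),
     (3, 1, [1,6,7,8], [5,6,7,8]), (3, 2, [1,6,7,9], [1,6,9,10]), (3, 1, [1,4,6,9], [4,5,6,9]),
     (2, 1, [1,6,8,10], [4,6,8,10]), (2, 1, [1,7,8,9], [4,7,8,9]), (3, 1, [1,7,9,10], [5,7,9,10]),
     (3, 1, [2,4,5,8], [2,5,8,10]), (2, 1, [3,4,5,7], [3,4,7,10]), (3, 1, [1,2,5,6,8], [1,2,3,5,6]),
     (3, 1, [1,2,5,9,10], [1,2,8,9,10]), (2, 3, [1,3,4,6,9], [1,2,3,4,9]),
     (2, 1, [1,3,4,6,10], [1,3,6,7,10]), (2, 1, [1,4,6,8,9], [1,6,7,8,9]),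
     (3, 1, [1,4,6,9,10], [4,5,6,9,10]), (1, 2, [2,3,4,7,8], [1,2,3,7,8]),
     (1, 3, [2,3,4,8,10], [2,3,4,5,10]), (3, 2, [2,4,5,6,8], [2,4,5,8,9]),
     (1, 2, [2,5,6,8,10], [5,6,7,8,10]), (2, 3, [3,4,5,7,9], [3,4,5,6,7]),
     (2, 3, [3,4,7,8,10], [4,7,8,9,10]), (2, 1, [1,4,6,8,9,10], [1,6,7,8,9,10]),
     (3, 2, [2,4,5,6,8,10], [2,4,5,8,9,10]), (2, 3, [3,4,5,7,9,10], [3,4,5,6,7,10]),
     (3, 1, [1,2,4,8,9,10], [1,2,3,4,9,10]), (2, 1, [1,2,3,4,5,9], [1,2,3,5,7,9]),
     (2, 3, [1,2,3,4,8,9], [1,2,3,4,6,8]), (3, 1, [1,2,3,4,5,6], [1,2,3,5,6,10]),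
     (1, 2, [1,2,3,6,7,8], [1,2,3,7,8,10]), (3, 2, [1,2,4,6,8,9], [1,2,5,6,8,9]),
     (2, 1, [1,3,4,6,7,8], [1,3,4,6,7,9]), (1, 3, [2,3,4,5,6,8], [2,3,4,5,7,8]),
     (3, 1, [4,5,6,7,8,10], [4,5,6,7,8,9]), (3, 1, [1,4,6,7,8,9,10], [1,3,4,6,7,9,10]),
     (2, 1, [1,3,4,5,6,7,9], [1,2,3,4,5,6,9]), (3, 1, [1,2,3,4,5,6,10], [1,2,3,4,6,8,10]),
     (2, 1, [1,2,3,4,5,9,10], [1,2,3,5,7,9,10]), (2, 3, [1,2,3,4,8,9,10], [1,2,3,4,7,8,9]),
     (3, 2, [1,2,3,5,6,7,10], [1,2,3,5,6,7,8]), (3, 1, [1,2,4,5,6,8,9], [1,2,5,6,8,9,10]),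
     (1, 2, [2,3,4,5,6,7,8], [2,3,4,5,7,8,10]), (3, 1, [1,2,3,4,5,6,7,8], [1,2,3,5,6,7,8,10]),
     (3, 2, [1,2,3,4,5,6,7,9], [1,2,3,4,5,6,9,10]), (2, 1, [1,2,3,4,5,7,8,9], [1,2,3,4,7,8,9,10]),
     (3, 1, [1,2,3,4,5,6,7,8,10], [1,2,3,4,5,6,7,8,9])]"

lemma elimination_table_correct: "elimination generator_lists elimination_table"
  by code_simp

text \<open>
  For \<open>a \<noteq> b\<close> the inner product \<open>\<langle>E\<^sub>a\<^sub>b a\<^sub>T, x\<rangle> = \<langle>a\<^sub>T, E\<^sub>b\<^sub>a x\<rangle>\<close> vanishes, so each entry of the table gives an
  equation \<open>c \<langle>a\<^sub>S, x\<rangle> = 0\<close> with \<open>c \<noteq> 0\<close>.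
\<close>

lemma elimination_sound:
  assumes x: "\<And>a b. a \<noteq> b \<Longrightarrow> root_derivation a b x = 0"
  shows "elimination K st \<Longrightarrow> \<forall>L\<in>set K. ext_inner (monomial L) x = 0 \<Longrightarrow>
    (a, b, T, S) \<in> set st \<Longrightarrow> ext_inner (monomial S) x = 0"
proof (induction K st rule: elimination.induct)
  case (2 K a' b' T' S' st)
  have known: "ext_inner (lincomb (filter (\<lambda>(c, l). c \<noteq> 0 \<and> l \<notin> set K) cs)) x = ext_inner (lincomb cs) x" for cs
    using "2.prems"(2) by (induction cs) (auto simp: ext_inner_add_left ext_inner_scale_left)
  have ab: "a' \<in> {1,2,3}" "b' \<in> {1,2,3}" "a' \<noteq> b'" and T': "set T' \<subseteq> {1..10}"
    and S': "map snd (filter (\<lambda>(c, l). c \<noteq> 0 \<and> l \<notin> set K) (collect (raise_terms a' b' T'))) = [S']"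
    and st: "elimination (S' # K) st"
    using "2.prems"(1) by auto
  obtain c where c: "filter (\<lambda>(c, l). c \<noteq> 0 \<and> l \<notin> set K) (collect (raise_terms a' b' T')) = [(c, S')]"
    using S' by auto
  then have "(c, S') \<in> set (filter (\<lambda>(c, l). c \<noteq> 0 \<and> l \<notin> set K) (collect (raise_terms a' b' T')))"
    by simp
  then have "c \<noteq> 0" by auto
  have "(of_nat b' :: 3) \<noteq> of_nat a'" using ab by auto
  then have "0 = ext_inner (root_derivation (of_nat a') (of_nat b') (monomial T')) x"
    by (simp add: root_derivation_adjoint x)
  also have "\<dots> = of_int c * ext_inner (monomial S') x"
    using known[of "collect (raise_terms a' b' T')"]
    by (simp add: root_derivation_monomial[OF ab(1,2) T'] c lincomb_collect
        ext_inner_scale_left)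
  finally have "ext_inner (monomial S') x = 0" using \<open>c \<noteq> 0\<close> by simp
  then show ?case using "2.IH"[OF st] "2.prems" by auto
qed simp

lemma weight_zero_lists:
  "set (filter (\<lambda>l. weight 1 l = weight 2 l \<and> weight 1 l = weight 3 l) (subseqs vol_list)) \<subseteq>
     set (generator_lists @ map (\<lambda>(a, b, T, S). S) elimination_table)"
  by code_simp

lemma strict_sorted_in_subseqs:
  "sorted_wrt (<) l \<Longrightarrow> set l \<subseteq> set xs \<Longrightarrow> sorted_wrt (<) xs \<Longrightarrow> l \<in> set (subseqs xs)"
  for l :: "nat list"
proof (induction xs arbitrary: l)
  case (Cons y xs)
  show ?case
  proof (cases "y \<in> set l")
    case True
    then obtain a l' where l: "l = a # l'" by (cases l) auto
    have "a = y" using True Cons.prems l by fastforce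
    then have "l' \<in> set (subseqs xs)" using Cons.prems l by (intro Cons.IH) auto
    then show ?thesis using l \<open>a = y\<close> by (simp add: Let_def)
  next
    case False
    then have "l \<in> set (subseqs xs)" using Cons.prems by (intro Cons.IH) auto
    then show ?thesis by (simp add: Let_def)
  qed
qed simp

text \<open>
  In weight zero the elimination table applies. Otherwise \<open>weight a l * \<langle>a\<^sub>l, x\<rangle> = \<langle>a\<^sub>l, E\<^sub>a\<^sub>a x\<rangle>\<close> is independent of
  \<open>a\<close>, which forces \<open>\<langle>a\<^sub>l, x\<rangle> = 0\<close> as soon as two of the three weights differ.
\<close>

lemma SL3_invariant_orthogonal:
  assumes x: "\<And>g. det g = 1 \<Longrightarrow> ext_map (tensor_action g) x = x"
    and base: "\<forall>L\<in>set generator_lists. ext_inner (monomial L) x = 0"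
    and l: "l \<in> basis_lists"
  shows "ext_inner (monomial l) x = 0"
proof (cases "weight 1 l = weight 2 l \<and> weight 1 l = weight 3 l")
  case True
  have "set vol_list = {1..10::nat}" unfolding atLeastAtMost_1_10 by simp
  then have "l \<in> set (subseqs vol_list)"
    using l by (intro strict_sorted_in_subseqs) (simp_all add: basis_lists_def)
  with True have "l \<in> set (filter (\<lambda>l. weight 1 l = weight 2 l \<and> weight 1 l = weight 3 l) (subseqs vol_list))"
    unfolding set_filter by blast
  then have "l \<in> set (generator_lists @ map (\<lambda>(a, b, T, S). S) elimination_table)"
    by (rule subsetD[OF weight_zero_lists])
  then consider "l \<in> set generator_lists" |
      "l \<in> set (map (\<lambda>(a, b, T, S). S) elimination_table)"
    unfolding set_append by blast
  then show ?thesis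
  proof cases
    case 1
    then show ?thesis using base by blast
  next
    case 2
    then obtain a b T where "(a, b, T, l) \<in> set elimination_table" by auto
    then show ?thesis
      using elimination_sound[OF root_derivation_zero_if_SL3_invariant[OF x] elimination_table_correct base]
      by blast
  qed
next
  case False
  have l10: "set l \<subseteq> {1..10}" using l by (simp add: basis_lists_def)
  define c where "c = ext_inner (monomial l) x"
  have "of_nat (weight a l) * c = ext_inner (monomial l) (root_derivation 1 1 x)" if "a \<in> {1,2,3}" for a
  proof -
    have "of_nat (weight a l) * c = ext_inner (monomial l) (root_derivation (of_nat a) (of_nat a) x)"
      using root_derivation_monomial_weight[OF that l10] root_derivation_adjoint
      by (metis c_def ext_inner_scale_left)
    then show ?thesis
      using diagonal_derivation_eq_if_SL3_invariant[OF x] by metis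
  qed
  then have "of_nat (weight 1 l) * c = of_nat (weight 2 l) * c"
    "of_nat (weight 1 l) * c = of_nat (weight 3 l) * c" by simp_all
  then show ?thesis using False by (auto simp flip: c_def)
qed

text \<open>
  Subtracting from an invariant \<open>x\<close> the combination \<open>y\<close> of \<open>1\<close>, \<open>v\<close>, \<open>*v\<close> and \<open>vol\<close> with the same inner
  products with the four monomials of \<open>generator_lists\<close> leaves an invariant orthogonal to all monomials.
\<close>

lemma sl3_invariants_subset_subalgebra:
  assumes X: "lincomb invariant3 \<in> subalgebra_generated X" "lincomb invariant7 \<in> subalgebra_generated X"
    "monomial vol_list \<in> subalgebra_generated X"
    and V: "monomial vol_list \<in> sl3_invariants"
  shows "sl3_invariants \<subseteq> subalgebra_generated X"
proof
  fix x assume x: "x \<in> sl3_invariants"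
  (* the conjugate accounts for the antilinearity of the inner product in its second argument *)
  define coord where "coord I = cnj (ext_inner (monomial I) x / (\<Prod>n\<leftarrow>I. basis_norm n))" for I
  define y where "y = coord [] *s ext_one + coord [1,2,3] *s lincomb invariant3 +
    (coord [4,5,6,7,8,9,10] / 9) *s lincomb invariant7 + coord vol_list *s monomial vol_list"
  have v: "\<forall>(c, l)\<in>set invariant3. set l \<subseteq> {1..10}" and w: "\<forall>(c, l)\<in>set invariant7. set l \<subseteq> {1..10}"
    using invariant3_basis invariant7_basis basis_listsD by fast+
  have "y \<in> sl3_invariants"
    unfolding y_def
    by (intro sl3_invariants_closed V lincomb_in_sl3_invariants v w raise_invariant3 raise_invariant7)
  then have "x + (- 1) *s y \<in> sl3_invariants"
    using x by (intro sl3_invariants_closed)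
  then have z: "x - y \<in> sl3_invariants" by (simp add: vec.scale_minus_left)
  have B: "I \<in> basis_lists" if "I \<in> set generator_lists" for I
    using that by (auto simp: basis_lists_def)
  have "ext_inner (monomial I) y = ext_inner (monomial I) x" if "I \<in> set generator_lists" for I
  proof -
    have "ext_inner (monomial I) y = cnj (coord I) * (\<Prod>n\<leftarrow>I. basis_norm n)"
      unfolding y_def ext_inner_add_right ext_inner_scale_right
        ext_inner_monomial_lincomb[OF B[OF that] invariant3_basis]
        ext_inner_monomial_lincomb[OF B[OF that] invariant7_basis]
        ext_inner_monomial[OF B[OF that] vol_list_basis] monomial_Nil[symmetric]
        ext_inner_monomial[OF B[OF that] B[of "[]", simplified]]
      using that
      by (simp only: list.set insert_iff empty_iff simp_thms; elim disjE;
          simp add: invariant3_def invariant7_def)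
    then show ?thesis using basis_norm_nonzero[of I] by (simp add: coord_def)
  qed
  then have base: "\<forall>I\<in>set generator_lists. ext_inner (monomial I) (x - y) = 0"
    by (simp only: ext_inner_diff_right) simp
  have "x - y = 0"
  proof (rule eq_0_if_orthogonal_to_basis)
    show "x - y \<in> vec.span (monomial ` basis_lists)"
      using z ext_algebra_subset_span by (auto simp: sl3_invariants_def)
    show "ext_inner (monomial l) (x - y) = 0" if "l \<in> basis_lists" for l
      using z by (intro SL3_invariant_orthogonal[OF _ base that]) (simp add: sl3_invariants_def)
  qed
  moreover have "y \<in> subalgebra_generated X"
    unfolding y_def by (intro subalgebra_generated.intros X)
  ultimately show "x \<in> subalgebra_generated X" by simp
qed

section \<open>The Hodge dual\<close>

lemma monomial_wedge_complement:
  assumes "I \<in> basis_lists" "J \<in> basis_lists" "length I + length J = 10"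
  shows "monomial I \<and>\<^sub>E monomial J =
    (if set I \<inter> set J = {} then of_int (sort_sign (I @ J)) *s monomial vol_list else 0)"
proof (cases "set I \<inter> set J = {}")
  case True
  have "distinct (I @ J)" using assms True by (simp add: basis_listsD)
  moreover have "set (I @ J) = {1..10}"
    using assms(3) basis_listsD[OF assms(1)] basis_listsD[OF assms(2)] distinct_card[OF \<open>distinct (I @ J)\<close>]
    by (intro card_subset_eq) auto
  moreover have "set vol_list = {1..10}" unfolding atLeastAtMost_1_10 by simp
  ultimately have "sort (I @ J) = vol_list"
    by (intro sorted_distinct_set_unique) simp_all
  then show ?thesis using True monomial_sort[of "I @ J"] by (simp add: monomial_append)
next
  case False
  then show ?thesis
    using monomial_eq_0_if_not_distinct[of "I @ J"] by (simp add: monomial_append)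
qed

lemma disjoint_iff_complement:
  assumes I: "I \<in> basis_lists" and J: "J \<in> basis_lists" and K: "K \<in> basis_lists"
    and "set J = {1..10} - set I" "length K = length I"
  shows "set K \<inter> set J = {} \<longleftrightarrow> K = I"
proof
  assume "set K \<inter> set J = {}"
  then have "set K \<subseteq> set I" using assms basis_listsD[OF K] by blast
  moreover have "card (set K) = card (set I)"
    using assms basis_listsD by (simp add: distinct_card)
  ultimately have "set K = set I" by (simp add: card_subset_eq)
  then show "K = I" using basis_listsD I K by (metis sorted_distinct_set_unique)
qed (use assms in auto)

lemma complement_length:
  assumes I: "I \<in> basis_lists" and J: "J \<in> basis_lists" and IJ: "set J = {1..10} - set I"
  shows "length I + length J = 10"
proof -
  have "card (set J) = 10 - card (set I)"
    using IJ basis_listsD[OF I] by (simp add: card_Diff_subset)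
  moreover have "card (set I) \<le> 10"
    using card_mono[of "{1..10::nat}" "set I"] basis_listsD[OF I] by simp
  ultimately show ?thesis
    using basis_listsD[OF I] basis_listsD[OF J] by (simp add: distinct_card)
qed

text \<open>
  Both sides are linear in \<open>u\<close>, and on monomials of degree \<open>length I\<close> both vanish except at \<open>a\<^sub>I\<close>.
\<close>

lemma wedge_monomial_complement:
  assumes I: "I \<in> basis_lists" and J: "J \<in> basis_lists" and IJ: "set J = {1..10} - set I"
    and u: "u \<in> ext_power (length I) S3V"
  shows "u \<and>\<^sub>E monomial J =
    (of_int (sort_sign (I @ J)) / (\<Prod>n\<leftarrow>I. basis_norm n) * ext_inner u (monomial I)) *s monomial vol_list"
proof -
  have len: "length I + length J = 10"
    using complement_length[OF I J IJ] by simp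
  have "u \<in> vec.span {monomial l |l. l \<in> basis_lists \<and> length l = length I}"
    using u ext_power_subset_span by blast
  then show ?thesis
  proof (induction rule: vec.span_induct_alt)
    case (step c x y)
    from step.hyps obtain K where K: "x = monomial K" "K \<in> basis_lists" "length K = length I" by blast
    have "x \<and>\<^sub>E monomial J =
        (of_int (sort_sign (I @ J)) / (\<Prod>n\<leftarrow>I. basis_norm n) * ext_inner x (monomial I)) *s monomial vol_list"
      unfolding K(1) ext_inner_monomial[OF K(2) I]
        monomial_wedge_complement[OF K(2) J len[folded K(3)]] disjoint_iff_complement[OF I J K(2) IJ K(3)]
      using basis_norm_nonzero[of I] by (cases "K = I") simp_all
    then show ?case
      unfolding wedge_add_left wedge_scale_left step.IH ext_inner_add_left ext_inner_scale_left
      by (simp only: vec.scale_scale flip: vec.scale_left_distrib) (simp only: algebra_simps)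
  qed simp
qed

text \<open>
  The mirror image of \<open>wedge_monomial_complement\<close>, used for uniqueness of the Hodge dual: wedging with
  the complementary monomial extracts the inner product with \<open>a\<^sub>J\<close>.
\<close>

lemma monomial_complement_wedge:
  assumes I: "I \<in> basis_lists" and J: "J \<in> basis_lists" and IJ: "set I = {1..10} - set J"
    and u: "u \<in> ext_power (length J) S3V"
  shows "monomial I \<and>\<^sub>E u =
    (of_int (sort_sign (I @ J)) / (\<Prod>n\<leftarrow>J. basis_norm n) * ext_inner u (monomial J)) *s monomial vol_list"
proof -
  have len: "length I + length J = 10"
    using complement_length[OF J I IJ] by simp
  have "u \<in> vec.span {monomial l |l. l \<in> basis_lists \<and> length l = length J}"
    using u ext_power_subset_span by blast
  then show ?thesis
  proof (induction rule: vec.span_induct_alt)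
    case (step c x y)
    from step.hyps obtain K where K: "x = monomial K" "K \<in> basis_lists" "length K = length J" by blast
    have "monomial I \<and>\<^sub>E x =
        (of_int (sort_sign (I @ J)) / (\<Prod>n\<leftarrow>J. basis_norm n) * ext_inner x (monomial J)) *s monomial vol_list"
      unfolding K(1) ext_inner_monomial[OF K(2) J] monomial_wedge_complement[OF I K(2) len[folded K(3)]]
        Int_commute[of "set I"] disjoint_iff_complement[OF J I K(2) IJ K(3)]
      using basis_norm_nonzero[of J] by (cases "K = J") simp_all
    then show ?case
      unfolding wedge_add_right wedge_scale_right step.IH ext_inner_add_left ext_inner_scale_left
      by (simp only: vec.scale_scale flip: vec.scale_left_distrib) (simp only: algebra_simps)
  qed simp
qed

lemma ext_power_wedge_cancel:
  assumes y: "y \<in> ext_power 7 S3V" and 0: "\<forall>u\<in>ext_power 3 S3V. u \<and>\<^sub>E y = 0"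
  shows "y = 0"
proof (rule eq_0_if_orthogonal_to_basis)
  have "{monomial l |l. l \<in> basis_lists \<and> length l = 7} = monomial ` {l \<in> basis_lists. length l = 7}"
    by auto
  then show "y \<in> vec.span (monomial ` {l \<in> basis_lists. length l = 7})"
    using subsetD[OF ext_power_subset_span y] by simp
  fix J assume "J \<in> {l \<in> basis_lists. length l = 7}"
  then have J: "J \<in> basis_lists" "length J = 7" by auto
  define I where "I = sorted_list_of_set ({1..10} - set J)"
  have I: "I \<in> basis_lists" "set I = {1..10} - set J"
    by (auto simp: I_def basis_lists_def)
  have "card (set J) = 7" using J basis_listsD[OF J(1)] by (simp add: distinct_card)
  then have "length I = 3"
    using basis_listsD[OF J(1)] by (simp add: I_def card_Diff_subset)
  then have "monomial I \<and>\<^sub>E y = 0"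
    using 0 monomial_in_ext_power[of I] basis_listsD[OF I(1)] by simp
  moreover have "sort_sign (I @ J) \<noteq> 0"
    using basis_listsD[OF J(1)] basis_listsD[OF I(1)] I(2) by (intro sort_sign_nonzero) auto
  ultimately show "ext_inner (monomial J) y = 0"
    using monomial_complement_wedge[OF I(1) J(1) I(2), of y] y J(2) basis_norm_nonzero[of J]
      monomial_vol_list_nonzero ext_inner_cnj[of y "monomial J"]
    by (simp add: vec.scale_eq_0_iff)
qed

lemma hodge_dual_eqI:
  assumes y: "y \<in> ext_power 7 S3V" and h: "\<And>u. u \<in> ext_power 3 S3V \<Longrightarrow> u \<and>\<^sub>E y = ext_inner u x *s w"
  shows "hodge_dual w x = y"
  unfolding hodge_dual_def
proof (rule the_equality)
  fix y' assume y': "y' \<in> ext_power 7 S3V \<and> (\<forall>u\<in>ext_power 3 S3V. u \<and>\<^sub>E y' = ext_inner u x *s w)"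
  have "y' - y \<in> ext_power 7 S3V"
    using y y' unfolding ext_power_def by (auto intro: vec.span_diff)
  moreover have "u \<and>\<^sub>E (y' - y) = 0" if "u \<in> ext_power 3 S3V" for u
    using wedge_add_right[of u "y' - y" y] h[OF that] y' that by simp
  ultimately show "y' = y" using ext_power_wedge_cancel[of "y' - y"] by simp
qed (use y h in auto)

lemma complement_if_sort_append:
  assumes "sort (I @ J) = vol_list"
  shows "set J = {1..10} - set I"
proof -
  have "set (I @ J) = set vol_list" "distinct (I @ J)"
    using arg_cong[OF assms, of set] arg_cong[OF assms, of distinct] by simp_all
  then show ?thesis unfolding atLeastAtMost_1_10 by auto
qed

text \<open>
  The Hodge dual of \<open>d a\<^sub>I\<close> for real \<open>d\<close> is \<open>c a\<^sub>J\<close>, with \<open>c\<close> given by the sign of the complementary pair and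
  the squared norm of \<open>a\<^sub>I\<close>.
\<close>

lemma wedge_hodge_term:
  assumes "u \<in> ext_power (length I) S3V" "I \<in> basis_lists" "J \<in> basis_lists" "set J = {1..10} - set I"
    and "of_int (sort_sign (I @ J)) * c = d * (\<Prod>n\<leftarrow>I. basis_norm n)" "cnj d = d"
  shows "u \<and>\<^sub>E (c *s monomial J) = (d * ext_inner u (monomial I)) *s monomial vol_list"
proof -
  let ?p = "\<Prod>n\<leftarrow>I. basis_norm n"
  have "c * of_int (sort_sign (I @ J)) / ?p = d"
    using assms(5) basis_norm_nonzero[of I] by (simp add: field_simps)
  then show ?thesis
    unfolding wedge_scale_right wedge_monomial_complement[OF assms(2,3,4,1)] vec.scale_scale
    by (metis (no_types) mult.assoc times_divide_eq_right)
qed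

theorem mainTheorem1:
  fixes v vol :: "(3 \<times> 3 \<times> 3) ext"
  assumes v_def: "v =
      monomial [1, 2, 3] - 3 *s monomial [3, 4, 7] - 3 *s monomial [1, 6, 9]
      + 3 *s monomial [2, 5, 8] + 6 *s monomial [7, 8, 10] - 6 *s monomial [4, 9, 10]
      + 6 *s monomial [5, 6, 10] + 3 *s monomial [5, 7, 9] + 3 *s monomial [4, 6, 8]"
    and vol_def: "vol = monomial [1, 2, 3, 4, 5, 6, 7, 8, 9, 10]"
  shows "sl3_invariants = subalgebra_generated {v, hodge_dual vol v} \<and>
    hodge_dual vol v =
      monomial [4, 5, 6, 7, 8, 9, 10] - (1/3) *s monomial [1, 2, 5, 6, 8, 9, 10]
      - (1/3) *s monomial [2, 3, 4, 5, 7, 8, 10] - (1/3) *s monomial [1, 3, 4, 6, 7, 9, 10]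
      - (1/9) *s monomial [1, 2, 3, 4, 5, 6, 9] + (1/9) *s monomial [1, 2, 3, 5, 6, 7, 8]
      - (1/9) *s monomial [1, 2, 3, 4, 7, 8, 9] - (1/9) *s monomial [1, 2, 3, 4, 6, 8, 10]
      + (1/9) *s monomial [1, 2, 3, 5, 7, 9, 10]"
proof -
  define w where "w = 
      monomial [4, 5, 6, 7, 8, 9, 10] - (1/3) *s monomial [1, 2, 5, 6, 8, 9, 10]
      - (1/3) *s monomial [2, 3, 4, 5, 7, 8, 10] - (1/3) *s monomial [1, 3, 4, 6, 7, 9, 10]
      - (1/9) *s monomial [1, 2, 3, 4, 5, 6, 9] + (1/9) *s monomial [1, 2, 3, 5, 6, 7, 8]
      - (1/9) *s monomial [1, 2, 3, 4, 7, 8, 9] - (1/9) *s monomial [1, 2, 3, 4, 6, 8, 10]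
      + (1/9) *s monomial [1, 2, 3, 5, 7, 9, 10]"
  have v: "v = lincomb invariant3"
    by (simp add: v_def invariant3_def vec_eq_iff)
  have w: "w = (1/9) *s lincomb invariant7"
    by (simp add: w_def invariant7_def vec_eq_iff algebra_simps)
  have hodge: "u \<and>\<^sub>E w = ext_inner u v *s vol" if u: "u \<in> ext_power 3 S3V" for u
  proof -
    have *: "I \<in> basis_lists \<Longrightarrow> J \<in> basis_lists \<Longrightarrow> sort (I @ J) = vol_list \<Longrightarrow> length I = 3 \<Longrightarrow>
        of_int (sort_sign (I @ J)) * c = of_int d * (\<Prod>n\<leftarrow>I. basis_norm n) \<Longrightarrow>
        u \<and>\<^sub>E (c *s monomial J) = ext_inner u (of_int d *s monomial I) *s monomial vol_list" for I J c d
      using wedge_hodge_term[of u I J c "of_int d"] complement_if_sort_append[of I J] u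
      by (simp add: ext_inner_scale_right)
    note S = basis_lists_def atLeastAtMost_1_10 basis_norm_def insert_Diff_if
    (* The nine complementary pairs: each term of v is dual to the term of w in the remaining indices. *)
    have terms:
      "u \<and>\<^sub>E (1 *s monomial [4, 5, 6, 7, 8, 9, 10]) = ext_inner u (of_int 1 *s monomial [1, 2, 3]) *s monomial vol_list"
      "u \<and>\<^sub>E ((- 1/3) *s monomial [1, 2, 5, 6, 8, 9, 10]) = ext_inner u (of_int (-3) *s monomial [3, 4, 7]) *s monomial vol_list"
      "u \<and>\<^sub>E ((- 1/3) *s monomial [2, 3, 4, 5, 7, 8, 10]) = ext_inner u (of_int (-3) *s monomial [1, 6, 9]) *s monomial vol_list"
      "u \<and>\<^sub>E ((- 1/3) *s monomial [1, 3, 4, 6, 7, 9, 10]) = ext_inner u (of_int 3 *s monomial [2, 5, 8]) *s monomial vol_list"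
      "u \<and>\<^sub>E ((- 1/9) *s monomial [1, 2, 3, 4, 5, 6, 9]) = ext_inner u (of_int 6 *s monomial [7, 8, 10]) *s monomial vol_list"
      "u \<and>\<^sub>E ((1/9) *s monomial [1, 2, 3, 5, 6, 7, 8]) = ext_inner u (of_int (-6) *s monomial [4, 9, 10]) *s monomial vol_list"
      "u \<and>\<^sub>E ((- 1/9) *s monomial [1, 2, 3, 4, 7, 8, 9]) = ext_inner u (of_int 6 *s monomial [5, 6, 10]) *s monomial vol_list"
      "u \<and>\<^sub>E ((- 1/9) *s monomial [1, 2, 3, 4, 6, 8, 10]) = ext_inner u (of_int 3 *s monomial [5, 7, 9]) *s monomial vol_list"
      "u \<and>\<^sub>E ((1/9) *s monomial [1, 2, 3, 5, 7, 9, 10]) = ext_inner u (of_int 3 *s monomial [4, 6, 8]) *s monomial vol_list"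
      by (rule *; simp add: S)+
    have "w = 1 *s monomial [4, 5, 6, 7, 8, 9, 10] +
        (- 1/3) *s monomial [1, 2, 5, 6, 8, 9, 10] +
        (- 1/3) *s monomial [2, 3, 4, 5, 7, 8, 10] +
        (- 1/3) *s monomial [1, 3, 4, 6, 7, 9, 10] +
        (- 1/9) *s monomial [1, 2, 3, 4, 5, 6, 9] +
        (1/9) *s monomial [1, 2, 3, 5, 6, 7, 8] +
        (- 1/9) *s monomial [1, 2, 3, 4, 7, 8, 9] +
        (- 1/9) *s monomial [1, 2, 3, 4, 6, 8, 10] +
        (1/9) *s monomial [1, 2, 3, 5, 7, 9, 10]"
      by (simp add: w_def vec_eq_iff)
    moreover have "v = of_int 1 *s monomial [1, 2, 3] +
        of_int (-3) *s monomial [3, 4, 7] +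
        of_int (-3) *s monomial [1, 6, 9] +
        of_int 3 *s monomial [2, 5, 8] +
        of_int 6 *s monomial [7, 8, 10] +
        of_int (-6) *s monomial [4, 9, 10] +
        of_int 6 *s monomial [5, 6, 10] +
        of_int 3 *s monomial [5, 7, 9] +
        of_int 3 *s monomial [4, 6, 8]"
      by (simp add: v_def vec_eq_iff)
    ultimately show ?thesis
      by (simp only: vol_def wedge_add_right ext_inner_add_right vec.scale_left_distrib terms)
  qed
  have w7: "w \<in> ext_power 7 S3V"
  proof -
    have "monomial l \<in> ext_power 7 S3V" if "set l \<subseteq> {1..10}" "length l = 7" for l
      using monomial_in_ext_power[OF that(1)] that(2) by simp
    then show ?thesis
      unfolding w_def ext_power_def
      by (intro vec.span_add vec.span_diff vec.span_scale) auto
  qed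
  have dual: "hodge_dual vol v = w" by (rule hodge_dual_eqI[OF w7 hodge])
  have v3: "v \<in> ext_power 3 S3V"
  proof -
    have "monomial l \<in> ext_power 3 S3V" if "set l \<subseteq> {1..10}" "length l = 3" for l
      using monomial_in_ext_power[OF that(1)] that(2) by simp
    then show ?thesis
      unfolding v_def ext_power_def
      by (intro vec.span_add vec.span_diff vec.span_scale) auto
  qed
  have v10: "\<forall>(c, l)\<in>set invariant3. set l \<subseteq> {1..10}" and w10: "\<forall>(c, l)\<in>set invariant7. set l \<subseteq> {1..10}"
    using invariant3_basis invariant7_basis basis_listsD by fast+
  have inv: "v \<in> sl3_invariants" "w \<in> sl3_invariants"
    unfolding v w by (intro sl3_invariants_closed lincomb_in_sl3_invariants v10 w10 raise_invariant3 raise_invariant7)+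
  have "ext_inner v v \<noteq> 0"
  proof
    assume "ext_inner v v = 0"
    then have "v = 0" by (rule ext_inner_self_eq_0)
    moreover have "[1, 2, 3] \<in> basis_lists" by (simp add: basis_lists_def)
    ultimately show False
      using ext_inner_monomial_lincomb[OF _ invariant3_basis, of "[1, 2, 3]"]
      by (simp add: v invariant3_def basis_norm_def)
  qed
  then have vol: "vol = (1 / ext_inner v v) *s (v \<and>\<^sub>E w)"
    by (simp add: hodge[OF v3])
  let ?X = "{v, hodge_dual vol v}"
  have vX: "v \<in> subalgebra_generated ?X" and wX: "w \<in> subalgebra_generated ?X"
    using subalgebra_generated.gen[of _ ?X] dual by auto
  have "lincomb invariant7 = 9 *s w" by (simp add: w)
  then have "sl3_invariants \<subseteq> subalgebra_generated ?X"
    using vX wX vol inv unfolding vol_def v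
    by (intro sl3_invariants_subset_subalgebra) (metis subalgebra_generated.scale subalgebra_generated.wedge sl3_invariants_closed)+
  moreover have "x \<in> sl3_invariants" if "x \<in> subalgebra_generated ?X" for x
    using that by induction (use inv dual sl3_invariants_closed in auto)
  ultimately show ?thesis
    using dual w_def by blast
qed

end
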